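(* For any prime $p$ such that $\sqrt{p-1}$ is an integer, there are infinitely many (pairwise non-isomorphic) finite solvable groups $G$ of order divisible by $p$ with $|\mathrm{Irr}_{p'}(G)| = 2\sqrt{p-1}$.
   Context: For a finite group $G$ and a prime $p$, $\mathrm{Irr}_{p'}(G)$ denotes the set of complex irreducible characters of $G$ whose degrees are prime to $p$. *)

theory Defs
  imports
    "HOL-Algebra.Solvable_Groups"
    "HOL-Computational_Algebra.Primes"
    "Jordan_Normal_Form.VS_Connect"
begin

abbreviation GL :: "nat \<Rightarrow> complex mat monoid" where
  "GL n \<equiv> units_of (ring_mat TYPE(complex) n ())"

definition invariant_subspace ::
  "('a, 'b) monoid_scheme \<Rightarrow> nat \<Rightarrow> ('a \<Rightarrow> complex mat) \<Rightarrow> complex vec set \<Rightarrow> bool" where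
  "invariant_subspace G n \<rho> W \<longleftrightarrow>
     VectorSpace.subspace class_ring W (module_vec TYPE(complex) n) \<and>
     (\<forall>g\<in>carrier G. \<forall>w\<in>W. \<rho> g *\<^sub>v w \<in> W)"

definition irreducible_rep ::
  "('a, 'b) monoid_scheme \<Rightarrow> nat \<Rightarrow> ('a \<Rightarrow> complex mat) \<Rightarrow> bool" where
  "irreducible_rep G n \<rho> \<longleftrightarrow>
     n > 0 \<and> \<rho> \<in> hom G (GL n) \<and>
     (\<forall>W. invariant_subspace G n \<rho> W \<longrightarrow> W = {0\<^sub>v n} \<or> W = carrier_vec n)"

text \<open>Characters are functions on the carrier of the group, hence restricted to it: two
  characters are equal iff they agree on the group.\<close>

definition rep_character ::
  "('a, 'b) monoid_scheme \<Rightarrow> nat \<Rightarrow> ('a \<Rightarrow> complex mat) \<Rightarrow> 'a \<Rightarrow> complex" where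
  "rep_character G n \<rho> = (\<lambda>g\<in>carrier G. \<Sum>i<n. \<rho> g $$ (i, i))"

definition Irr :: "('a, 'b) monoid_scheme \<Rightarrow> ('a \<Rightarrow> complex) set" where
  "Irr G = {rep_character G n \<rho> | n \<rho>. irreducible_rep G n \<rho>}"

text \<open>The degree of a character \<open>\<chi>\<close> is its value at the identity, a natural number.\<close>

definition Irr_p' :: "nat \<Rightarrow> ('a, 'b) monoid_scheme \<Rightarrow> ('a \<Rightarrow> complex) set" where
  "Irr_p' p G = {\<chi> \<in> Irr G. \<exists>d::nat. \<chi> \<one>\<^bsub>G\<^esub> = of_nat d \<and> coprime d p}"

end

theory Submission
  imports
    Defs
    "HOL-Algebra.Elementary_Groups"
    "HOL-Algebra.Weak_Morphisms"
    "HOL-Number_Theory.Pocklington"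
    "Jordan_Normal_Form.Spectral_Radius"
begin

text \<open>
  Write \<open>p - 1 = m\<^sup>2\<close> and let \<open>F = C\<^sub>p : C\<^sub>m\<close> act faithfully and affinely on the integers modulo \<open>p\<close>. It has
  \<open>m\<close> linear characters and \<open>(p - 1) / m = m\<close> irreducible characters of degree \<open>m\<close>, induced from \<open>C\<^sub>p\<close>,
  and \<open>m\<close> is prime to \<open>p\<close>. For every \<open>q\<close> prime to \<open>p\<close>, let \<open>G = V : F\<close>, where \<open>V\<close> consists of the functions
  from the integers modulo \<open>p\<close> to the integers modulo \<open>q\<close> with sum zero. As \<open>C\<^sub>p\<close> has no nontrivial fixed
  point on \<open>V\<close>, every irreducible character of \<open>G\<close> that is nontrivial on \<open>V\<close> has degree divisible by \<open>p\<close>.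
  So the irreducible characters of \<open>G\<close> of degree prime to \<open>p\<close> are exactly the \<open>2 m\<close> characters inflated
  from \<open>F\<close>, and the order of \<open>G\<close> is unbounded in \<open>q\<close>.
\<close>

section \<open>Matrix representations and Schur's lemma\<close>

text \<open>For every divisor m of p - 1 the group F has m + (p - 1) / m irreducible characters, of
  degrees 1 and m; the choice m = sqrt(p - 1) balances the two terms. The sum-zero condition on V
  removes the constant functions, which are exactly what C_p fixes: a constant with sum zero modulo
  q is zero because q is prime to p. So q = p N + 1 is available for every bound N. Irr(F) is found
  from eigenvectors: an eigenvector of a translation yields a nonzero intertwiner from a model
  representation, and Schur's lemma does the rest. Fourier inversion on C_p tells the induced
  characters apart. Divisibility of degrees by p is a trace computation: the sum of
  \<open>\<rho>\<close> over a subgroup H is card H times an idempotent, while for H = C_p the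
  traces vanish off the identity as soon as V acts nontrivially. As the groups of the family must
  share one type, each is finally copied to the natural numbers.\<close>

lemma invariant_subspace_iff:
  "invariant_subspace G n \<rho> W \<longleftrightarrow>
     W \<subseteq> carrier_vec n \<and> 0\<^sub>v n \<in> W \<and> (\<forall>v\<in>W. \<forall>w\<in>W. v + w \<in> W) \<and> (\<forall>c. \<forall>v\<in>W. c \<cdot>\<^sub>v v \<in> W) \<and>
     (\<forall>g\<in>carrier G. \<forall>w\<in>W. \<rho> g *\<^sub>v w \<in> W)"
proof -
  interpret vec_space "TYPE(complex)" n .
  show ?thesis
    unfolding invariant_subspace_def VectorSpace.subspace_def submodule_def
    using vec_vs vec_module by (auto simp: module_vec_simps)
qed

text \<open>Invertibility comes for free, since the value at the inverse element is an inverse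
  matrix; only products and the identity have to be checked.\<close>

lemma hom_GL_I:
  assumes "group G" and "\<And>g. g \<in> carrier G \<Longrightarrow> \<rho> g \<in> carrier_mat n n"
    and "\<And>g h. g \<in> carrier G \<Longrightarrow> h \<in> carrier G \<Longrightarrow> \<rho> (g \<otimes>\<^bsub>G\<^esub> h) = \<rho> g * \<rho> h"
    and "\<rho> \<one>\<^bsub>G\<^esub> = 1\<^sub>m n"
  shows "\<rho> \<in> hom G (GL n)"
proof (rule homI)
  fix g assume g: "g \<in> carrier G"
  interpret group G by fact
  have "\<rho> g * \<rho> (inv\<^bsub>G\<^esub> g) = 1\<^sub>m n" "\<rho> (inv\<^bsub>G\<^esub> g) * \<rho> g = 1\<^sub>m n"
    using g assms(3)[of g "inv\<^bsub>G\<^esub> g"] assms(3)[of "inv\<^bsub>G\<^esub> g" g] assms(4) by auto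
  then show "\<rho> g \<in> carrier (GL n)"
    using assms(2)[OF g] assms(2)[of "inv\<^bsub>G\<^esub> g"] g
    by (auto simp: units_of_def Units_def ring_mat_simps)
next
  fix g h assume "g \<in> carrier G" "h \<in> carrier G"
  then show "\<rho> (g \<otimes>\<^bsub>G\<^esub> h) = \<rho> g \<otimes>\<^bsub>GL n\<^esub> \<rho> h"
    using assms(3) by (simp add: units_of_def ring_mat_simps)
qed

locale mat_rep = group G for G (structure) +
  fixes n :: nat and \<rho> :: "'a \<Rightarrow> complex mat"
  assumes rep_hom: "\<rho> \<in> hom G (GL n)"
begin

lemma rep_carrier [simp]: "g \<in> carrier G \<Longrightarrow> \<rho> g \<in> carrier_mat n n"
  using rep_hom by (auto simp: hom_def units_of_def Units_def ring_mat_simps)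

lemma rep_dim [simp]:
  "g \<in> carrier G \<Longrightarrow> dim_row (\<rho> g) = n" "g \<in> carrier G \<Longrightarrow> dim_col (\<rho> g) = n"
  using rep_carrier by blast+

lemma rep_mult: "g \<in> carrier G \<Longrightarrow> h \<in> carrier G \<Longrightarrow> \<rho> (g \<otimes> h) = \<rho> g * \<rho> h"
  using rep_hom by (simp add: hom_def units_of_def ring_mat_simps)

text \<open>An idempotent with a left inverse \<open>B\<close> is the identity.\<close>

lemma rep_one [simp]: "\<rho> \<one> = 1\<^sub>m n"
proof -
  have "\<rho> \<one> \<in> Units (ring_mat TYPE(complex) n ())"
    using rep_hom by (auto simp: hom_def units_of_def)
  then obtain B where B: "B \<in> carrier_mat n n" "B * \<rho> \<one> = 1\<^sub>m n"
    by (auto simp: Units_def ring_mat_simps)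
  have "\<rho> \<one> = B * \<rho> \<one> * \<rho> \<one>" using B by simp
  also have "\<dots> = B * (\<rho> \<one> * \<rho> \<one>)" using B by (intro assoc_mult_mat) auto
  also have "\<rho> \<one> * \<rho> \<one> = \<rho> \<one>" using rep_mult[of \<one> \<one>] by simp
  finally show ?thesis using B by simp
qed

lemma rep_vec_mult:
  assumes "g \<in> carrier G" "h \<in> carrier G" "v \<in> carrier_vec n"
  shows "\<rho> (g \<otimes> h) *\<^sub>v v = \<rho> g *\<^sub>v (\<rho> h *\<^sub>v v)"
  using assms by (simp add: rep_mult assoc_mult_mat_vec[of _ n n _ n])

lemma rep_vec_closed [simp]:
  "g \<in> carrier G \<Longrightarrow> v \<in> carrier_vec n \<Longrightarrow> \<rho> g *\<^sub>v v \<in> carrier_vec n"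
  by (rule mult_mat_vec_carrier[of _ n n]) simp_all

end

locale irred_rep = mat_rep +
  assumes irreducible: "irreducible_rep G n \<rho>"
begin

lemma dim_pos: "n > 0"
  using irreducible by (simp add: irreducible_rep_def)

lemma invariant_subspace_trivial:
  "invariant_subspace G n \<rho> W \<Longrightarrow> W = {0\<^sub>v n} \<or> W = carrier_vec n"
  using irreducible by (simp add: irreducible_rep_def)

end

lemma (in group) irred_repI: "irreducible_rep G n \<rho> \<Longrightarrow> irred_rep G n \<rho>"
  by unfold_locales (auto simp: irreducible_rep_def)

text \<open>Linear combinations are written coordinatewise, the form in which the Fourier
  projections and the expansion in unit vectors appear below.\<close>

lemma vec_sum_in_subspace:
  fixes W :: "complex vec set"
  assumes zero: "0\<^sub>v n \<in> W" and add: "\<forall>v\<in>W. \<forall>w\<in>W. v + w \<in> W" and smult: "\<forall>c. \<forall>v\<in>W. c \<cdot>\<^sub>v v \<in> W"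
    and sub: "W \<subseteq> carrier_vec n" and fin: "finite B" and u: "\<And>b. b \<in> B \<Longrightarrow> u b \<in> W"
  shows "vec n (\<lambda>k. \<Sum>b\<in>B. c b * u b $ k) \<in> W"
  using fin u
proof (induction B rule: finite_induct)
  case empty
  have "vec n (\<lambda>k. 0) = (0\<^sub>v n :: complex vec)" by auto
  with zero show ?case by simp
next
  case (insert x B)
  have [simp]: "dim_vec (u x) = n" using insert.prems sub by (auto dest!: carrier_vecD)
  have "vec n (\<lambda>k. \<Sum>b\<in>insert x B. c b * u b $ k) = c x \<cdot>\<^sub>v u x + vec n (\<lambda>k. \<Sum>b\<in>B. c b * u b $ k)"
    using insert by (intro eq_vecI) auto
  with insert add smult show ?case by simp
qed

lemma trace_mult_commute:
  fixes A :: "'a :: comm_semiring_0 mat"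
  assumes "A \<in> carrier_mat n k" "B \<in> carrier_mat k n"
  shows "(\<Sum>i<n. (A * B) $$ (i, i)) = (\<Sum>i<k. (B * A) $$ (i, i))"
proof -
  have "(\<Sum>i<n. (A * B) $$ (i, i)) = (\<Sum>i<n. \<Sum>j<k. A $$ (i, j) * B $$ (j, i))"
    using assms by (auto simp: scalar_prod_def atLeast0LessThan intro!: sum.cong)
  also have "\<dots> = (\<Sum>j<k. \<Sum>i<n. B $$ (j, i) * A $$ (i, j))"
    by (subst sum.swap) (simp add: mult.commute)
  also have "\<dots> = (\<Sum>i<k. (B * A) $$ (i, i))"
    using assms by (auto simp: scalar_prod_def atLeast0LessThan intro!: sum.cong)
  finally show ?thesis .
qed

lemma eq_matI_mult_vec:
  fixes A B :: "'a :: comm_semiring_1 mat"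
  assumes "A \<in> carrier_mat n k" "B \<in> carrier_mat n k"
    and "\<And>v. v \<in> carrier_vec k \<Longrightarrow> A *\<^sub>v v = B *\<^sub>v v"
  shows "A = B"
proof (rule eq_matI)
  fix i j assume ij: "i < dim_row B" "j < dim_col B"
  have "A $$ (i, j) = (A *\<^sub>v unit_vec k j) $ i" "B $$ (i, j) = (B *\<^sub>v unit_vec k j) $ i"
    using assms(1,2) ij by (simp_all add: scalar_prod_right_unit)
  then show "A $$ (i, j) = B $$ (i, j)" using assms(3)[of "unit_vec k j"] by simp
qed (use assms in auto)

text \<open>Schur's lemma: kernel and image of \<open>M\<close> are invariant, hence trivial and
  full respectively, so \<open>M\<close> is invertible and conjugates one representation into the
  other. Thus a single nonzero intertwiner identifies an unknown irreducible character with a known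
  one.\<close>

lemma intertwiner_rep_character_eq:
  assumes G: "group G" and "irreducible_rep G n \<rho>" and "irreducible_rep G k \<phi>"
    and M: "M \<in> carrier_mat n k" "M \<noteq> 0\<^sub>m n k"
    and inter: "\<And>g. g \<in> carrier G \<Longrightarrow> M * \<phi> g = \<rho> g * M"
  shows "rep_character G n \<rho> = rep_character G k \<phi>"
proof -
  interpret group G by fact
  interpret R: irred_rep G n \<rho> by (rule irred_repI) fact
  interpret P: irred_rep G k \<phi> by (rule irred_repI) fact
  have inter_vec: "M *\<^sub>v (\<phi> g *\<^sub>v v) = \<rho> g *\<^sub>v (M *\<^sub>v v)" if "g \<in> carrier G" "v \<in> carrier_vec k" for g v
    using inter[OF that(1)] that M
    by (metis P.rep_carrier R.rep_carrier assoc_mult_mat_vec)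
  have nz: "\<exists>v\<in>carrier_vec k. M *\<^sub>v v \<noteq> 0\<^sub>v n"
  proof (rule ccontr)
    assume "\<not> ?thesis"
    then have "M = 0\<^sub>m n k" using M by (intro eq_matI_mult_vec[of _ n k]) auto
    with M show False by simp
  qed
  define W where "W = {v \<in> carrier_vec k. M *\<^sub>v v = 0\<^sub>v n}"
  have "invariant_subspace G k \<phi> W"
    unfolding invariant_subspace_iff W_def using M
    by (auto simp: mult_add_distrib_mat_vec mult_mat_vec inter_vec)
  then have ker: "W = {0\<^sub>v k}"
    using P.invariant_subspace_trivial nz unfolding W_def by blast
  define U where "U = (\<lambda>v. M *\<^sub>v v) ` carrier_vec k"
  have "invariant_subspace G n \<rho> U"
    unfolding invariant_subspace_iff
  proof (intro conjI ballI allI)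
    show "0\<^sub>v n \<in> U" unfolding U_def using M by (intro image_eqI[of _ _ "0\<^sub>v k"]) auto
  next
    fix v w assume "v \<in> U" "w \<in> U"
    then obtain x y where "v = M *\<^sub>v x" "w = M *\<^sub>v y" "x \<in> carrier_vec k" "y \<in> carrier_vec k"
      unfolding U_def by auto
    then show "v + w \<in> U" unfolding U_def using M
      by (intro image_eqI[of _ _ "x + y"]) (auto simp: mult_add_distrib_mat_vec)
  next
    fix v c assume "v \<in> U"
    then obtain x where "v = M *\<^sub>v x" "x \<in> carrier_vec k" unfolding U_def by auto
    then show "c \<cdot>\<^sub>v v \<in> U" unfolding U_def using M
      by (intro image_eqI[of _ _ "c \<cdot>\<^sub>v x"]) (auto simp: mult_mat_vec)
  next
    fix v g assume g: "g \<in> carrier G" "v \<in> U"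
    then obtain x where "v = M *\<^sub>v x" "x \<in> carrier_vec k" unfolding U_def by auto
    then show "\<rho> g *\<^sub>v v \<in> U" unfolding U_def using M g
      by (intro image_eqI[of _ _ "\<phi> g *\<^sub>v x"]) (auto simp: inter_vec)
  qed (use M in \<open>auto simp: U_def\<close>)
  then have im: "U = carrier_vec n"
    using R.invariant_subspace_trivial nz unfolding U_def by blast
  \<comment> \<open>Preimages of the unit vectors form the columns of a right inverse
    \<open>N\<close>; injectivity of \<open>M\<close> then makes it a left inverse as well, although
    \<open>n\<close> and \<open>k\<close> have not been compared.\<close>
  have "\<forall>i. \<exists>x. i < n \<longrightarrow> x \<in> carrier_vec k \<and> M *\<^sub>v x = unit_vec n i"
    using im unfolding U_def by (metis imageE unit_vec_carrier)
  then obtain f where f: "\<And>i. i < n \<Longrightarrow> f i \<in> carrier_vec k \<and> M *\<^sub>v f i = unit_vec n i"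
    by metis
  define N where "N = mat k n (\<lambda>(i, j). f j $ i)"
  have N: "N \<in> carrier_mat k n" by (simp add: N_def)
  have colN: "col N j = f j" if "j < n" for j
    using that f[OF that] by (intro eq_vecI) (auto simp: N_def)
  have MN: "M * N = 1\<^sub>m n"
  proof (rule mat_col_eqI)
    fix i assume "i < dim_col (1\<^sub>m n :: complex mat)"
    then have i: "i < n" by simp
    have "col (M * N) i = M *\<^sub>v col N i" using M(1) N i by (rule col_mult2)
    then show "col (M * N) i = col (1\<^sub>m n) i" using f[OF i] i by (simp add: colN)
  qed (use M N in auto)
  have inj: "x = 0\<^sub>v k" if "x \<in> carrier_vec k" "M *\<^sub>v x = 0\<^sub>v n" for x
    using ker that unfolding W_def by blast
  have NM: "N * M = 1\<^sub>m k"
  proof (rule eq_matI_mult_vec[of _ k k])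
    fix v :: "complex vec" assume v: "v \<in> carrier_vec k"
    have "M *\<^sub>v (N *\<^sub>v (M *\<^sub>v v)) = M *\<^sub>v v"
      using M N v MN by (metis assoc_mult_mat_vec mult_mat_vec_carrier one_mult_mat_vec)
    then have "M *\<^sub>v (N *\<^sub>v (M *\<^sub>v v) - v) = 0\<^sub>v n"
      using M N v by (simp add: mult_minus_distrib_mat_vec[of _ n k])
    then have 0: "N *\<^sub>v (M *\<^sub>v v) - v = 0\<^sub>v k"
      using M N v by (intro inj) auto
    have "N *\<^sub>v (M *\<^sub>v v) = v"
    proof (rule eq_vecI)
      fix i assume i: "i < dim_vec v"
      then have "(N *\<^sub>v (M *\<^sub>v v) - v) $ i = 0" using 0 v by simp
      then show "(N *\<^sub>v (M *\<^sub>v v)) $ i = v $ i" using i by simp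
    qed (use N v in auto)
    then show "N * M *\<^sub>v v = 1\<^sub>m k *\<^sub>v v" using M N v by (simp add: assoc_mult_mat_vec[of _ k n _ k])
  qed (use M N in auto)
  have "(\<Sum>i<n. \<rho> g $$ (i, i)) = (\<Sum>i<k. \<phi> g $$ (i, i))" if g: "g \<in> carrier G" for g
  proof -
    have "\<rho> g = M * (\<phi> g * N)"
    proof -
      have "\<rho> g = \<rho> g * (M * N)" using g MN by simp
      also have "\<dots> = M * \<phi> g * N" using M N g by (simp add: inter assoc_mult_mat[of _ n n _ k _ n])
      also have "\<dots> = M * (\<phi> g * N)" using M N g by (simp add: assoc_mult_mat[of _ n k _ k _ n])
      finally show ?thesis .
    qed
    moreover have "\<phi> g * N * M = \<phi> g"
      using M N g NM by (simp add: assoc_mult_mat[of _ k k _ n _ k])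
    moreover have "(\<Sum>i<n. (M * (\<phi> g * N)) $$ (i, i)) = (\<Sum>i<k. (\<phi> g * N * M) $$ (i, i))"
      using M N g by (intro trace_mult_commute) auto
    ultimately show ?thesis by simp
  qed
  then show ?thesis unfolding rep_character_def by (intro restrict_ext) auto
qed

section \<open>Degrees in the presence of a normal subgroup\<close>

context irred_rep
begin

text \<open>The vectors fixed by a normal subgroup form an invariant subspace; if it is nonzero,
  irreducibility makes it the whole space.\<close>

lemma normal_fixed_vec_imp_trivial:
  assumes N: "N \<lhd> G" and v: "v \<in> carrier_vec n" "v \<noteq> 0\<^sub>v n"
    and fixed: "\<And>k. k \<in> N \<Longrightarrow> \<rho> k *\<^sub>v v = v" and k: "k \<in> N"
  shows "\<rho> k = 1\<^sub>m n"
proof -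
  interpret N: normal N G by fact
  define W where "W = {v \<in> carrier_vec n. \<forall>k\<in>N. \<rho> k *\<^sub>v v = v}"
  have "\<rho> k *\<^sub>v (\<rho> g *\<^sub>v w) = \<rho> g *\<^sub>v w" if "g \<in> carrier G" "k \<in> N" "w \<in> W" for g k w
  proof -
    have kG: "k \<in> carrier G" using that by simp
    have "inv g \<otimes> k \<otimes> g \<in> N" using that N.inv_op_closed1 by blast
    then have "\<rho> g *\<^sub>v w = \<rho> g *\<^sub>v (\<rho> (inv g \<otimes> k \<otimes> g) *\<^sub>v w)" using that by (simp add: W_def)
    also have "\<dots> = \<rho> (g \<otimes> (inv g \<otimes> k \<otimes> g)) *\<^sub>v w"
      using that kG by (intro rep_vec_mult[symmetric]) (auto simp: W_def)
    also have "g \<otimes> (inv g \<otimes> k \<otimes> g) = k \<otimes> g"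
      using that kG by (simp add: m_assoc flip: m_assoc[of g])
    also have "\<rho> (k \<otimes> g) *\<^sub>v w = \<rho> k *\<^sub>v (\<rho> g *\<^sub>v w)"
      using that kG by (intro rep_vec_mult) (auto simp: W_def)
    finally show ?thesis by simp
  qed
  then have "invariant_subspace G n \<rho> W"
    unfolding invariant_subspace_iff
    by (auto simp: W_def mult_add_distrib_mat_vec[of _ n n] mult_mat_vec[of _ n n])
  then have "W = carrier_vec n"
    using invariant_subspace_trivial v fixed unfolding W_def by blast
  then show ?thesis
    using k by (intro eq_matI_mult_vec[of _ n n]) (auto simp: W_def)
qed

end

section \<open>Traces of scaled idempotents and sums over subgroups\<close>

lemma upper_triangular_mult_diag:
  fixes A :: "'a :: comm_semiring_0 mat"
  assumes "A \<in> carrier_mat n n" "B \<in> carrier_mat n n" "upper_triangular A" "upper_triangular B" "i < n"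
  shows "(A * B) $$ (i, i) = A $$ (i, i) * B $$ (i, i)"
proof -
  have "(A * B) $$ (i, i) = (\<Sum>j<n. A $$ (i, j) * B $$ (j, i))"
    using assms by (auto simp: scalar_prod_def atLeast0LessThan intro!: sum.cong)
  also have "\<dots> = (\<Sum>j<n. if j = i then A $$ (i, i) * B $$ (i, i) else 0)"
  proof (rule sum.cong)
    fix j assume "j \<in> {..<n}"
    then show "A $$ (i, j) * B $$ (j, i) = (if j = i then A $$ (i, i) * B $$ (i, i) else 0)"
      using assms by (cases j i rule: linorder_cases) (auto dest: upper_triangularD)
  qed simp
  finally show ?thesis using assms by simp
qed

text \<open>All eigenvalues are 0 or \<open>c\<close>: after Schur triangularisation each diagonal
  entry x satisfies x * x = c * x. The number \<open>r\<close> counts the nonzero diagonal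
  entries.\<close>

lemma trace_scaled_idempotent:
  fixes A :: "complex mat"
  assumes A: "A \<in> carrier_mat n n" and "A * A = c \<cdot>\<^sub>m A"
  shows "\<exists>r::nat. (\<Sum>i<n. A $$ (i, i)) = c * of_nat r"
proof -
  obtain es where "char_poly A = (\<Prod>a\<leftarrow>es. [:- a, 1:])"
    using char_poly_factorized[OF A] by blast
  then obtain B where B: "B \<in> carrier_mat n n" "upper_triangular B" "similar_mat A B"
    using schur_decomposition_exists[OF A] by blast
  then obtain P Q where "similar_mat_wit A B P Q" unfolding similar_mat_def by blast
  note PQ = similar_mat_witD2[OF A this]
  note carr = PQ(4-7) and assoc = assoc_mult_mat[of _ n n _ n _ n]
  have "Q * A = Q * (P * (B * Q))"
    unfolding PQ(3) using carr by (simp add: assoc)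
  also have "\<dots> = Q * P * (B * Q)"
    using carr by (intro assoc_mult_mat[symmetric, of _ n n _ n _ n]) auto
  finally have QA: "Q * A = B * Q" using carr by (simp add: PQ(2))
  have B_eq: "Q * (A * P) = B"
  proof -
    have "Q * (A * P) = Q * A * P" using carr by (simp add: assoc)
    also have "\<dots> = B * (Q * P)" using carr by (simp add: QA assoc)
    finally show ?thesis using carr by (simp add: PQ(2))
  qed
  have "B * B = B * (Q * (A * P))" by (simp add: B_eq)
  also have "\<dots> = B * Q * (A * P)"
    using carr by (intro assoc_mult_mat[symmetric, of _ n n _ n _ n]) auto
  also have "\<dots> = Q * A * (A * P)" by (simp add: QA)
  also have "\<dots> = Q * (A * (A * P))" using carr by (simp add: assoc)
  also have "A * (A * P) = A * A * P"
    using carr by (intro assoc_mult_mat[symmetric, of _ n n _ n _ n]) auto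
  also have "Q * (A * A * P) = c \<cdot>\<^sub>m (Q * (A * P))"
    using carr by (simp add: assms(2) mult_smult_distrib[of _ n n _ n] mult_smult_assoc_mat[of _ n n _ n])
  finally have BB: "B * B = c \<cdot>\<^sub>m B" by (simp add: B_eq)
  have diag: "B $$ (i, i) = (if B $$ (i, i) = 0 then 0 else c)" if "i < n" for i
  proof -
    have "B $$ (i, i) * B $$ (i, i) = (c \<cdot>\<^sub>m B) $$ (i, i)"
      using upper_triangular_mult_diag[OF B(1) B(1) B(2) B(2) that] BB by simp
    then have "B $$ (i, i) * B $$ (i, i) = c * B $$ (i, i)" using B(1) that by simp
    then show ?thesis by (metis mult_cancel_right)
  qed
  have "(\<Sum>i<n. A $$ (i, i)) = (\<Sum>i<n. (P * (B * Q)) $$ (i, i))"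
    unfolding PQ(3) using carr by (simp add: assoc)
  also have "\<dots> = (\<Sum>i<n. (B * Q * P) $$ (i, i))"
    using carr by (intro trace_mult_commute) auto
  also have "B * Q * P = B" using carr by (simp add: assoc PQ(2))
  also have "(\<Sum>i<n. B $$ (i, i)) = (\<Sum>i<n. if B $$ (i, i) = 0 then 0 else c)"
    by (rule sum.cong) (rule refl, rule diag, simp)
  also have "\<dots> = c * of_nat (card ({..<n} \<inter> - {i. B $$ (i, i) = 0}))"
    by (simp add: sum.If_cases mult.commute)
  finally show ?thesis by blast
qed

context mat_rep
begin

text \<open>For a subgroup \<open>H\<close> this is \<open>card H\<close> times the projection onto
  the vectors fixed by \<open>H\<close>. Leaving out the factor keeps the entries plain
  sums.\<close>

definition rep_sum :: "'a set \<Rightarrow> complex mat" where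
  "rep_sum H = mat n n (\<lambda>(i, j). \<Sum>h\<in>H. \<rho> h $$ (i, j))"

lemma rep_sum_carrier [simp]: "rep_sum H \<in> carrier_mat n n"
  by (simp add: rep_sum_def)

lemma mult_rep_sum:
  assumes "H \<subseteq> carrier G" "A \<in> carrier_mat n n" "i < n" "j < n"
  shows "(A * rep_sum H) $$ (i, j) = (\<Sum>h\<in>H. (A * \<rho> h) $$ (i, j))"
    and "(rep_sum H * A) $$ (i, j) = (\<Sum>h\<in>H. (\<rho> h * A) $$ (i, j))"
proof -
  have *: "dim_row (\<rho> h) = n" "dim_col (\<rho> h) = n" if "h \<in> H" for h using assms that by auto
  have "(A * rep_sum H) $$ (i, j) = (\<Sum>l<n. \<Sum>h\<in>H. A $$ (i, l) * \<rho> h $$ (l, j))"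
    using assms by (auto simp: rep_sum_def scalar_prod_def atLeast0LessThan sum_distrib_left intro!: sum.cong)
  also have "\<dots> = (\<Sum>h\<in>H. (A * \<rho> h) $$ (i, j))"
    using assms * by (subst sum.swap) (auto simp: scalar_prod_def atLeast0LessThan intro!: sum.cong)
  finally show "(A * rep_sum H) $$ (i, j) = (\<Sum>h\<in>H. (A * \<rho> h) $$ (i, j))" .
  have "(rep_sum H * A) $$ (i, j) = (\<Sum>l<n. \<Sum>h\<in>H. \<rho> h $$ (i, l) * A $$ (l, j))"
    using assms by (auto simp: rep_sum_def scalar_prod_def atLeast0LessThan sum_distrib_right intro!: sum.cong)
  also have "\<dots> = (\<Sum>h\<in>H. (\<rho> h * A) $$ (i, j))"
    using assms * by (subst sum.swap) (auto simp: scalar_prod_def atLeast0LessThan intro!: sum.cong)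
  finally show "(rep_sum H * A) $$ (i, j) = (\<Sum>h\<in>H. (\<rho> h * A) $$ (i, j))" .
qed

lemma rep_mult_rep_sum:
  assumes H: "subgroup H G" and h: "h \<in> H"
  shows "\<rho> h * rep_sum H = rep_sum H"
proof (rule eq_matI)
  interpret H: subgroup H G by fact
  fix i j assume "i < dim_row (rep_sum H)" "j < dim_col (rep_sum H)"
  then have ij: "i < n" "j < n" by (simp_all add: rep_sum_def)
  have bij: "bij_betw (\<lambda>k. h \<otimes> k) H H"
    using H h by (intro bij_betw_byWitness[where f' = "\<lambda>k. inv h \<otimes> k"]) (auto simp flip: m_assoc)
  have "(\<rho> h * rep_sum H) $$ (i, j) = (\<Sum>k\<in>H. (\<rho> h * \<rho> k) $$ (i, j))"
    using ij h by (intro mult_rep_sum) auto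
  also have "\<dots> = (\<Sum>k\<in>H. \<rho> (h \<otimes> k) $$ (i, j))"
    using h by (intro sum.cong) (auto simp: rep_mult)
  also have "\<dots> = (\<Sum>k\<in>H. \<rho> k $$ (i, j))"
    using bij by (rule sum.reindex_bij_betw)
  also have "\<dots> = rep_sum H $$ (i, j)" using ij by (simp add: rep_sum_def)
  finally show "(\<rho> h * rep_sum H) $$ (i, j) = rep_sum H $$ (i, j)" .
qed (use assms in \<open>auto simp: rep_sum_def dest: subgroup.mem_carrier\<close>)

text \<open>\<open>rep_sum H\<close> squares to \<open>card H\<close> times itself, since left
  multiplication by an element of \<open>H\<close> permutes the summands. The number
  \<open>r\<close> is the dimension of the space fixed by \<open>H\<close>.\<close>

lemma sum_trace_subgroup:
  assumes H: "subgroup H G"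
  shows "\<exists>r::nat. (\<Sum>h\<in>H. \<Sum>i<n. \<rho> h $$ (i, i)) = of_nat (card H) * of_nat r"
proof -
  interpret H: subgroup H G by fact
  have "rep_sum H * rep_sum H = of_nat (card H) \<cdot>\<^sub>m rep_sum H"
  proof (rule eq_matI)
    fix i j assume "i < dim_row (of_nat (card H) \<cdot>\<^sub>m rep_sum H)" "j < dim_col (of_nat (card H) \<cdot>\<^sub>m rep_sum H)"
    then have ij: "i < n" "j < n" by (simp_all add: rep_sum_def)
    have "(rep_sum H * rep_sum H) $$ (i, j) = (\<Sum>h\<in>H. (\<rho> h * rep_sum H) $$ (i, j))"
      using ij by (intro mult_rep_sum) auto
    also have "\<dots> = (\<Sum>h\<in>H. rep_sum H $$ (i, j))"
      using H by (intro sum.cong) (simp_all add: rep_mult_rep_sum)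
    finally show "(rep_sum H * rep_sum H) $$ (i, j) = (of_nat (card H) \<cdot>\<^sub>m rep_sum H) $$ (i, j)"
      using ij by (simp add: rep_sum_def)
  qed (auto simp: rep_sum_def)
  then obtain r :: nat where "(\<Sum>i<n. rep_sum H $$ (i, i)) = of_nat (card H) * of_nat r"
    using trace_scaled_idempotent[OF rep_sum_carrier] by blast
  moreover have "(\<Sum>h\<in>H. \<Sum>i<n. \<rho> h $$ (i, i)) = (\<Sum>i<n. rep_sum H $$ (i, i))"
    by (subst sum.swap) (simp add: rep_sum_def)
  ultimately show ?thesis by auto
qed

lemma trace_conj:
  assumes "g \<in> carrier G" "h \<in> carrier G"
  shows "(\<Sum>i<n. \<rho> (g \<otimes> h \<otimes> inv g) $$ (i, i)) = (\<Sum>i<n. \<rho> h $$ (i, i))"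
proof -
  have "(\<Sum>i<n. \<rho> (g \<otimes> h \<otimes> inv g) $$ (i, i)) = (\<Sum>i<n. (\<rho> g * \<rho> (h \<otimes> inv g)) $$ (i, i))"
    using assms by (simp add: m_assoc flip: rep_mult)
  also have "\<dots> = (\<Sum>i<n. (\<rho> (h \<otimes> inv g) * \<rho> g) $$ (i, i))"
    using assms by (intro trace_mult_commute) auto
  also have "\<dots> = (\<Sum>i<n. \<rho> h $$ (i, i))"
    using assms by (simp add: m_assoc flip: rep_mult)
  finally show ?thesis .
qed

end

text \<open>If \<open>h\<close> centralises no nontrivial element of \<open>N\<close>, then all elements of the coset \<open>N h\<close> are
  conjugate to \<open>h\<close>; if moreover \<open>N\<close> has no nonzero fixed vector, then \<open>\<Sum>\<^sub>k \<rho> k = 0\<close> over \<open>N\<close> and so the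
  character vanishes at \<open>h\<close>. Hence the multiplicity of the trivial character of \<open>H\<close> is
  \<open>n / card H\<close>.\<close>

lemma (in irred_rep) fixed_point_free_imp_card_dvd_degree:
  assumes fin: "finite (carrier G)" and N: "N \<lhd> G" and H: "subgroup H G"
    and fpf: "\<And>h k. h \<in> H \<Longrightarrow> h \<noteq> \<one> \<Longrightarrow> k \<in> N \<Longrightarrow> k \<otimes> h = h \<otimes> k \<Longrightarrow> k = \<one>"
    and nontriv: "\<exists>k\<in>N. \<rho> k \<noteq> 1\<^sub>m n"
  shows "card H dvd n"
proof -
  interpret N: normal N G by fact
  interpret H: subgroup H G by fact
  have finN: "finite N" using fin N.subset finite_subset by blast
  have finH: "finite H" using fin H.subset finite_subset by blast
  \<comment> \<open>Otherwise some vector in the image of \<open>rep_sum N\<close> would be nonzero,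
    and it is fixed by \<open>N\<close>.\<close>
  have N0: "rep_sum N = 0\<^sub>m n n"
  proof (rule ccontr)
    assume "rep_sum N \<noteq> 0\<^sub>m n n"
    then obtain v where v: "v \<in> carrier_vec n" "rep_sum N *\<^sub>v v \<noteq> 0\<^sub>v n"
      using eq_matI_mult_vec[OF rep_sum_carrier zero_carrier_mat, of N] by fastforce
    have "\<rho> k *\<^sub>v (rep_sum N *\<^sub>v v) = rep_sum N *\<^sub>v v" if "k \<in> N" for k
    proof -
      have "\<rho> k *\<^sub>v (rep_sum N *\<^sub>v v) = \<rho> k * rep_sum N *\<^sub>v v"
        using that v by (intro assoc_mult_mat_vec[symmetric, of _ n n _ n]) auto
      then show ?thesis using that rep_mult_rep_sum[OF N.subgroup_axioms] by simp
    qed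
    then have "\<forall>k\<in>N. \<rho> k = 1\<^sub>m n"
      using normal_fixed_vec_imp_trivial[OF N, of "rep_sum N *\<^sub>v v"] v
        mult_mat_vec_carrier[OF rep_sum_carrier v(1)] by blast
    with nontriv show False by blast
  qed
  have vanish: "(\<Sum>i<n. \<rho> h $$ (i, i)) = 0" if h: "h \<in> H" "h \<noteq> \<one>" for h
  proof -
    \<comment> \<open>\<open>f k\<close> is the commutator of \<open>k\<close> and \<open>h\<close>.
      It lies in \<open>N\<close> by normality, and \<open>f k \<otimes> h\<close> is the conjugate
      of \<open>h\<close> by \<open>k\<close>. If \<open>f k = f l\<close>, then
      \<open>inv l \<otimes> k\<close> commutes with \<open>h\<close>, so fixed-point-freeness makes
      \<open>f\<close> a permutation of the finite set \<open>N\<close>.\<close>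
    define f where "f k = k \<otimes> (h \<otimes> inv k \<otimes> inv h)" for k
    have "f k \<in> N" if "k \<in> N" for k
      unfolding f_def using that h N.inv_op_closed2[of h "inv k"] by simp
    then have f_mem: "f ` N \<subseteq> N" by blast
    have f_mult: "f k \<otimes> h = k \<otimes> h \<otimes> inv k" if "k \<in> N" for k
      using that h by (simp add: f_def m_assoc)
    have "inj_on f N"
    proof (rule inj_onI)
      fix k l assume kl: "k \<in> N" "l \<in> N" "f k = f l"
      then have eq: "k \<otimes> h \<otimes> inv k = l \<otimes> h \<otimes> inv l" using f_mult by metis
      have G: "k \<in> carrier G" "l \<in> carrier G" "h \<in> carrier G" using kl h by auto
      have "inv l \<otimes> k \<otimes> h = inv l \<otimes> (k \<otimes> h \<otimes> inv k) \<otimes> k"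
        using G by (simp add: m_assoc)
      also have "\<dots> = h \<otimes> (inv l \<otimes> k)"
        using G unfolding eq by (simp add: m_assoc flip: m_assoc[of "inv l" l])
      finally have "inv l \<otimes> k = \<one>" using fpf[OF h] kl by simp
      then show "k = l" using G by (metis inv_equality inv_inv inv_closed)
    qed
    then have bij: "bij_betw f N N"
      using f_mem finN by (simp add: bij_betw_def endo_inj_surj)
    have "of_nat (card N) * (\<Sum>i<n. \<rho> h $$ (i, i)) = (\<Sum>k\<in>N. \<Sum>i<n. \<rho> (k \<otimes> h \<otimes> inv k) $$ (i, i))"
      using h by (simp add: trace_conj)
    also have "\<dots> = (\<Sum>k\<in>N. \<Sum>i<n. \<rho> (f k \<otimes> h) $$ (i, i))"
      by (intro sum.cong) (simp_all add: f_mult)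
    also have "\<dots> = (\<Sum>k\<in>N. \<Sum>i<n. \<rho> (k \<otimes> h) $$ (i, i))"
      using sum.reindex_bij_betw[OF bij, of "\<lambda>k. \<Sum>i<n. \<rho> (k \<otimes> h) $$ (i, i)"] .
    also have "\<dots> = (\<Sum>k\<in>N. \<Sum>i<n. (\<rho> k * \<rho> h) $$ (i, i))"
      using h by (intro sum.cong) (simp_all add: rep_mult)
    also have "\<dots> = (\<Sum>i<n. (rep_sum N * \<rho> h) $$ (i, i))"
      using h by (subst sum.swap, intro sum.cong) (auto simp: mult_rep_sum N.subset)
    also have "\<dots> = 0"
      using h by (simp add: N0)
    finally have "of_nat (card N) * (\<Sum>i<n. \<rho> h $$ (i, i)) = 0" .
    moreover have "N \<noteq> {}" using N.one_closed by blast
    ultimately show ?thesis using finN by simp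
  qed
  obtain r :: nat where "(\<Sum>h\<in>H. \<Sum>i<n. \<rho> h $$ (i, i)) = of_nat (card H) * of_nat r"
    using sum_trace_subgroup[OF H] by blast
  moreover have "(\<Sum>h\<in>H. \<Sum>i<n. \<rho> h $$ (i, i)) = (\<Sum>h\<in>H. if h = \<one> then of_nat n else 0)"
    by (intro sum.cong) (auto simp: vanish)
  ultimately have "(of_nat n :: complex) = of_nat (card H * r)" using finH by simp
  then have "n = card H * r" by (simp only: of_nat_eq_iff)
  then show ?thesis by simp
qed

section \<open>Inflation and deflation of characters along a surjection\<close>

lemma rep_character_one:
  assumes "group G" "irreducible_rep G n \<rho>"
  shows "rep_character G n \<rho> \<one>\<^bsub>G\<^esub> = of_nat n"
proof -
  interpret group G by fact
  interpret irred_rep G n \<rho> by (rule irred_repI) fact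
  show ?thesis by (simp add: rep_character_def)
qed

lemma Irr_p'_eq:
  assumes "group G"
  shows "Irr_p' p G = {rep_character G n \<rho> | n \<rho>. irreducible_rep G n \<rho> \<and> coprime n p}"
  unfolding Irr_p'_def Irr_def using rep_character_one[OF assms] by (fastforce simp del: of_nat_eq_iff dest: of_nat_eq_iff[THEN iffD1])

lemma irreducible_rep_inflate:
  assumes G: "group G" and F: "group F" and \<pi>: "\<pi> \<in> hom G F" "\<pi> ` carrier G = carrier F"
    and irr: "irreducible_rep F n \<phi>"
  shows "irreducible_rep G n (\<phi> \<circ> \<pi>)"
  unfolding irreducible_rep_def
proof (intro conjI allI impI)
  interpret F: group F by fact
  interpret irred_rep F n \<phi> by (rule F.irred_repI) fact
  show "n > 0" by (rule dim_pos)
  show "\<phi> \<circ> \<pi> \<in> hom G (GL n)" using \<pi>(1) rep_hom by (rule hom_compose)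
  fix W assume "invariant_subspace G n (\<phi> \<circ> \<pi>) W"
  then have "invariant_subspace F n \<phi> W"
    unfolding invariant_subspace_iff \<pi>(2)[symmetric] by auto
  then show "W = {0\<^sub>v n} \<or> W = carrier_vec n" by (rule invariant_subspace_trivial)
qed

lemma irreducible_rep_deflate:
  assumes G: "group G" and F: "group F" and \<pi>: "\<pi> \<in> hom G F" "\<pi> ` carrier G = carrier F"
    and irr: "irreducible_rep G n \<rho>" and ker: "\<And>k. k \<in> kernel G F \<pi> \<Longrightarrow> \<rho> k = 1\<^sub>m n"
  obtains \<phi> where "irreducible_rep F n \<phi>" "\<And>g. g \<in> carrier G \<Longrightarrow> \<phi> (\<pi> g) = \<rho> g"
proof -
  interpret group_hom G F \<pi> using G F \<pi> by (simp add: group_hom_def group_hom_axioms_def)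
  interpret irred_rep G n \<rho> by (rule G.irred_repI) fact
  \<comment> \<open>An arbitrary section of \<open>\<pi>\<close> will do: two preimages differ by a
    kernel element, on which \<open>\<rho>\<close> is trivial.\<close>
  define \<phi> where "\<phi> x = \<rho> (inv_into (carrier G) \<pi> x)" for x
  have \<phi>: "\<phi> (\<pi> g) = \<rho> g" if g: "g \<in> carrier G" for g
  proof -
    define h where "h = inv_into (carrier G) \<pi> (\<pi> g)"
    have h: "h \<in> carrier G" "\<pi> h = \<pi> g"
      unfolding h_def using g by (auto intro: inv_into_into f_inv_into_f)
    then have "h \<otimes>\<^bsub>G\<^esub> inv\<^bsub>G\<^esub> g \<in> kernel G F \<pi>" using g by (simp add: kernel_def)
    then have "\<rho> (h \<otimes>\<^bsub>G\<^esub> inv\<^bsub>G\<^esub> g) = 1\<^sub>m n" by (rule ker)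
    moreover have "\<rho> h = \<rho> (h \<otimes>\<^bsub>G\<^esub> inv\<^bsub>G\<^esub> g) * \<rho> g" using g h by (simp add: G.m_assoc flip: rep_mult)
    ultimately show ?thesis using g by (simp add: \<phi>_def h_def)
  qed
  have surj: "\<exists>g\<in>carrier G. x = \<pi> g" if "x \<in> carrier F" for x using \<pi>(2) that by auto
  have "irreducible_rep F n \<phi>"
    unfolding irreducible_rep_def
  proof (intro conjI allI impI)
    show "n > 0" by (rule dim_pos)
    show "\<phi> \<in> hom F (GL n)"
    proof (rule hom_GL_I[OF F])
      fix x assume "x \<in> carrier F"
      then show "\<phi> x \<in> carrier_mat n n" using surj[of x] by (auto simp: \<phi>)
    next
      fix x y assume "x \<in> carrier F" "y \<in> carrier F"
      then obtain g h where "g \<in> carrier G" "h \<in> carrier G" "x = \<pi> g" "y = \<pi> h" using surj by metis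
      then show "\<phi> (x \<otimes>\<^bsub>F\<^esub> y) = \<phi> x * \<phi> y" by (simp add: \<phi> rep_mult flip: hom_mult)
    next
      show "\<phi> \<one>\<^bsub>F\<^esub> = 1\<^sub>m n" using \<phi>[of "\<one>\<^bsub>G\<^esub>"] by simp
    qed
    fix W assume "invariant_subspace F n \<phi> W"
    then have "invariant_subspace G n \<rho> W"
      unfolding invariant_subspace_iff \<pi>(2)[symmetric] by (auto simp: \<phi>)
    then show "W = {0\<^sub>v n} \<or> W = carrier_vec n" by (rule invariant_subspace_trivial)
  qed
  with \<phi> that show ?thesis by blast
qed

text \<open>Composition with \<open>\<pi>\<close> is injective on characters because
  \<open>\<pi>\<close> is onto, and \<open>ker\<close> lets every irreducible representation of
  degree prime to \<open>p\<close> descend. This serves both the projection of the extension onto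
  the affine group and the passage to an isomorphic copy.\<close>

lemma card_Irr_p'_inflate:
  assumes G: "group G" and F: "group F" and \<pi>: "\<pi> \<in> hom G F" "\<pi> ` carrier G = carrier F"
    and ker: "\<And>n \<rho> k. irreducible_rep G n \<rho> \<Longrightarrow> coprime n p \<Longrightarrow> k \<in> kernel G F \<pi> \<Longrightarrow> \<rho> k = 1\<^sub>m n"
  shows "card (Irr_p' p G) = card (Irr_p' p F)"
proof -
  define infl where "infl \<chi> = (\<lambda>g\<in>carrier G. \<chi> (\<pi> g) :: complex)" for \<chi>
  have infl: "infl (rep_character F n \<phi>) = rep_character G n \<rho>"
    if "\<And>g. g \<in> carrier G \<Longrightarrow> \<phi> (\<pi> g) = \<rho> g" for n \<phi> \<rho>
    unfolding infl_def rep_character_def using \<pi>(2) that by (intro restrict_ext) auto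
  have "bij_betw infl (Irr_p' p F) (Irr_p' p G)"
    unfolding bij_betw_def
  proof (intro conjI equalityI subsetI)
    show "inj_on infl (Irr_p' p F)"
    proof (rule inj_onI)
      fix \<chi> \<psi> assume *: "\<chi> \<in> Irr_p' p F" "\<psi> \<in> Irr_p' p F" "infl \<chi> = infl \<psi>"
      then have ext: "\<chi> \<in> extensional (carrier F)" "\<psi> \<in> extensional (carrier F)"
        by (auto simp: Irr_p'_def Irr_def rep_character_def)
      show "\<chi> = \<psi>"
      proof (rule extensionalityI[OF ext])
        fix x assume "x \<in> carrier F"
        then obtain g where "g \<in> carrier G" "x = \<pi> g" using \<pi>(2) by auto
        then show "\<chi> x = \<psi> x" using fun_cong[OF *(3), of g] by (simp add: infl_def)
      qed
    qed
  next
    fix \<chi> assume "\<chi> \<in> infl ` Irr_p' p F"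
    then obtain n \<phi> where *: "irreducible_rep F n \<phi>" "coprime n p" "\<chi> = infl (rep_character F n \<phi>)"
      unfolding Irr_p'_eq[OF F] by auto
    then have "\<chi> = rep_character G n (\<phi> \<circ> \<pi>)" by (auto intro: infl)
    with * show "\<chi> \<in> Irr_p' p G"
      using irreducible_rep_inflate[OF G F \<pi>] unfolding Irr_p'_eq[OF G] by blast
  next
    fix \<chi> assume "\<chi> \<in> Irr_p' p G"
    then obtain n \<rho> where *: "irreducible_rep G n \<rho>" "coprime n p" "\<chi> = rep_character G n \<rho>"
      unfolding Irr_p'_eq[OF G] by auto
    obtain \<phi> where "irreducible_rep F n \<phi>" "\<And>g. g \<in> carrier G \<Longrightarrow> \<phi> (\<pi> g) = \<rho> g"
      using irreducible_rep_deflate[OF G F \<pi> *(1) ker[OF *(1,2)]] by blast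
    with * show "\<chi> \<in> infl ` Irr_p' p F"
      unfolding Irr_p'_eq[OF F] by (auto simp: infl intro!: image_eqI)
  qed
  then show ?thesis by (simp add: bij_betw_same_card)
qed

section \<open>The affine group and its representations\<close>

definition unity_root :: "nat \<Rightarrow> nat \<Rightarrow> complex" where
  "unity_root n k = cis (2 * pi * real k / real n)"

lemma unity_root_0 [simp]: "unity_root n 0 = 1"
  by (simp add: unity_root_def)

lemma unity_root_add: "unity_root n (j + k) = unity_root n j * unity_root n k"
  by (simp add: unity_root_def cis_mult add_divide_distrib ring_distribs)

lemma unity_root_power: "unity_root n k ^ j = unity_root n (j * k)"
  by (induction j) (simp_all add: unity_root_add)

lemma unity_root_self [simp]: "unity_root n n = 1"
  by (cases "n = 0") (simp_all add: unity_root_def)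

lemma unity_root_mult_self [simp]: "unity_root n (j * n) = 1"
  by (metis unity_root_power unity_root_self power_one)

lemma unity_root_mod [simp]: "unity_root n (k mod n) = unity_root n k"
  using unity_root_add[of n "k div n * n" "k mod n"] by simp

lemma unity_root_cong: "[j = k] (mod n) \<Longrightarrow> unity_root n j = unity_root n k"
  by (metis cong_def unity_root_mod)

lemma unity_root_eq_1_iff:
  assumes "n > 0"
  shows "unity_root n k = 1 \<longleftrightarrow> n dvd k"
proof
  assume "unity_root n k = 1"
  then have "unity_root n (k mod n) = unity_root n 0" by simp
  then have "k mod n = 0"
    using bij_betw_imp_inj_on[OF bij_betw_roots_unity[OF assms]] assms
    by (auto simp: unity_root_def inj_on_def)
  then show "n dvd k" by auto
qed (auto simp: mult.commute[of n])

lemma ex_unity_root: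
  assumes "n > 0" "z ^ n = 1"
  obtains k where "k < n" "z = unity_root n k"
  using bij_betw_roots_unity[OF assms(1)] assms(2)
  unfolding bij_betw_def unity_root_def by blast

text \<open>A geometric series. This orthogonality relation of the cyclic group is behind all
  Fourier arguments below.\<close>

lemma sum_unity_root:
  assumes "n > 0"
  shows "(\<Sum>b<n. unity_root n (b * c)) = (if n dvd c then of_nat n else 0)"
proof (cases "n dvd c")
  case True
  then have "unity_root n (b * c) = 1" for b by (simp add: unity_root_eq_1_iff assms)
  with True show ?thesis by simp
next
  case False
  then have "unity_root n c \<noteq> 1" by (simp add: unity_root_eq_1_iff assms)
  moreover have "(\<Sum>b<n. unity_root n c ^ b) = (1 - unity_root n c ^ n) / (1 - unity_root n c)"
    using calculation by (simp add: sum_gp_strict)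
  moreover have "unity_root n c ^ n = 1"
    by (metis mult.commute unity_root_mult_self unity_root_power)
  ultimately show ?thesis using False by (simp add: unity_root_power)
qed

text \<open>The pair (b, j) stands for the map t -> b + a^j t on the integers modulo
  \<open>p\<close>. Storing the exponent instead of the multiplier makes the projection onto the
  cyclic group of order \<open>m\<close> the second coordinate.\<close>

definition affine_group :: "nat \<Rightarrow> nat \<Rightarrow> nat \<Rightarrow> (nat \<times> nat) monoid" where
  "affine_group p m a =
     \<lparr>carrier = {..<p} \<times> {..<m},
      monoid.mult = (\<lambda>(b, j) (b', j'). ((b + a ^ j * b') mod p, (j + j') mod m)),
      one = (0, 0)\<rparr>"

text \<open>The order \<open>m\<close> of the multiplier is left arbitrary; the relation p - 1 = m *
  m enters only in the final theorem. Since \<open>ord\<close> is 0 for a multiplier that is not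
  coprime to \<open>p\<close>, positivity of \<open>m\<close> contains the coprimality of
  \<open>a\<close> and \<open>p\<close>.\<close>

locale affine =
  fixes p m a :: nat
  assumes p: "prime p" and m_pos: "m > 0" and ord_a: "ord p a = m"
begin

abbreviation "F \<equiv> affine_group p m a"

lemma p_pos: "p > 0" and p_gt_1: "p > 1"
  using p prime_gt_1_nat prime_gt_0_nat by auto

lemma F_carrier [simp]: "(b, j) \<in> carrier F \<longleftrightarrow> b < p \<and> j < m"
  by (simp add: affine_group_def)

lemma F_mult [simp]: "(b, j) \<otimes>\<^bsub>F\<^esub> (b', j') = ((b + a ^ j * b') mod p, (j + j') mod m)"
  by (simp add: affine_group_def)

lemma F_one [simp]: "\<one>\<^bsub>F\<^esub> = (0, 0)"
  by (simp add: affine_group_def)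

lemma finite_F: "finite (carrier F)"
  by (simp add: affine_group_def)

lemma coprime_a: "coprime p a"
  using ord_a m_pos ord_eq_0[of p a] by auto

lemma a_pow_cong_iff: "[a ^ i = a ^ j] (mod p) \<longleftrightarrow> i mod m = j mod m"
  using order_divides_expdiff[OF coprime_a] ord_a by (simp add: cong_def)

lemma a_pow_mod: "[a ^ (i mod m) = a ^ i] (mod p)"
  by (simp add: a_pow_cong_iff)

lemma mult_a_pow_mod: "(x * a ^ (i mod m)) mod p = (x * a ^ i) mod p"
  using a_pow_mod[of i] by (metis cong_def mod_mult_right_eq)

lemma coprime_a_pow: "coprime p (a ^ i)"
  using coprime_a by (simp add: coprime_power_right_iff)

sublocale F: group F
proof (rule groupI)
  show "\<one>\<^bsub>F\<^esub> \<in> carrier F" using p_pos m_pos by simp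
next
  fix x y assume "x \<in> carrier F" "y \<in> carrier F"
  then show "x \<otimes>\<^bsub>F\<^esub> y \<in> carrier F" using p_pos m_pos by (cases x; cases y) simp
next
  fix x assume "x \<in> carrier F"
  then show "\<one>\<^bsub>F\<^esub> \<otimes>\<^bsub>F\<^esub> x = x" by (cases x) simp
next
  fix x y z assume "x \<in> carrier F" "y \<in> carrier F" "z \<in> carrier F"
  obtain b j b' j' b'' j'' where eqs: "x = (b, j)" "y = (b', j')" "z = (b'', j'')"
    by (cases x; cases y; cases z)
  have "((b + a ^ j * b') mod p + a ^ ((j + j') mod m) * b'') mod p
      = (b + a ^ j * b' + b'' * a ^ ((j + j') mod m)) mod p"
    by (simp add: mod_simps mult.commute)
  also have "\<dots> = (b + a ^ j * b' + b'' * a ^ (j + j')) mod p"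
    by (metis mult_a_pow_mod mod_add_right_eq)
  also have "b + a ^ j * b' + b'' * a ^ (j + j') = b + a ^ j * (b' + a ^ j' * b'')"
    by (simp add: power_add algebra_simps)
  also have "\<dots> mod p = (b + a ^ j * ((b' + a ^ j' * b'') mod p)) mod p"
    by (metis mod_add_right_eq mod_mult_right_eq)
  finally show "x \<otimes>\<^bsub>F\<^esub> y \<otimes>\<^bsub>F\<^esub> z = x \<otimes>\<^bsub>F\<^esub> (y \<otimes>\<^bsub>F\<^esub> z)"
    unfolding eqs by (simp add: mod_simps add.assoc)
next
  fix x assume x: "x \<in> carrier F"
  obtain b j where eqs: "x = (b, j)" by (cases x)
  have bj: "b < p" "j < m" using x eqs by auto
  \<comment> \<open>The inverse map t -> a^(-j) (t - b), with \<open>m - j\<close> for the exponent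
    -j and \<open>p - b\<close> for -b. The outer reduction modulo \<open>m\<close> handles j =
    0.\<close>
  let ?y = "((a ^ (m - j) * (p - b)) mod p, (m - j) mod m)"
  have "((a ^ (m - j) * (p - b)) mod p + a ^ ((m - j) mod m) * b) mod p
      = (a ^ (m - j) * (p - b) + b * a ^ ((m - j) mod m)) mod p"
    by (simp add: mod_simps mult.commute)
  also have "\<dots> = (a ^ (m - j) * (p - b) + b * a ^ (m - j)) mod p"
    by (metis mult_a_pow_mod mod_add_right_eq)
  also have "a ^ (m - j) * (p - b) + b * a ^ (m - j) = a ^ (m - j) * (p - b + b)"
    by (simp add: algebra_simps)
  also have "\<dots> mod p = 0" using bj by simp
  finally have "?y \<otimes>\<^bsub>F\<^esub> x = \<one>\<^bsub>F\<^esub>"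
    using bj unfolding eqs by (simp add: mod_simps)
  moreover have "?y \<in> carrier F" using p_pos m_pos by simp
  ultimately show "\<exists>y\<in>carrier F. y \<otimes>\<^bsub>F\<^esub> x = \<one>\<^bsub>F\<^esub>" by blast
qed

lemma snd_hom: "(\<lambda>x. int (snd x)) \<in> hom F (integer_mod_group m)"
  using m_pos by (auto simp: hom_def carrier_integer_mod_group zmod_int)

sublocale snd_hom: group_hom F "integer_mod_group m" "\<lambda>x. int (snd x)"
  by (intro group_hom.intro group_hom_axioms.intro F.is_group group_integer_mod_group snd_hom)

definition "translations = kernel F (integer_mod_group m) (\<lambda>x. int (snd x))"

lemma translations_eq: "translations = {(b, 0) | b. b < p}"
  using m_pos by (auto simp: translations_def kernel_def)

lemma translations_normal: "translations \<lhd> F"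
  unfolding translations_def by (rule snd_hom.normal_kernel)

section \<open>The model representations of degrees 1 and m\<close>

definition lin_rep :: "nat \<Rightarrow> nat \<times> nat \<Rightarrow> complex mat" where
  "lin_rep t = (\<lambda>(b, j). mat 1 1 (\<lambda>_. unity_root m (t * j)))"

text \<open>The monomial representation induced from the character b ->
  \<open>unity_root p (s * b)\<close> of the translations. Row \<open>k\<close> carries the
  conjugate character with parameter s a^k, and its only nonzero entry is in column k + j modulo
  \<open>m\<close>.\<close>

definition ind_rep :: "nat \<Rightarrow> nat \<times> nat \<Rightarrow> complex mat" where
  "ind_rep s = (\<lambda>(b, j). mat m m (\<lambda>(k, i). if (k + j) mod m = i then unity_root p (s * b * a ^ k) else 0))"

lemma ind_rep_mult_index:
  assumes "j < m" "dim_col M = m" "r < dim_row M" "i < m"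
  shows "(M * ind_rep s (b, j)) $$ (r, i)
      = M $$ (r, (i + (m - j)) mod m) * unity_root p (s * b * a ^ (i + (m - j)))"
proof -
  \<comment> \<open>The row i - j modulo \<open>m\<close>, in which column \<open>i\<close> has its
    only nonzero entry; adding \<open>m - j\<close> avoids a truncated subtraction.\<close>
  let ?k = "(i + (m - j)) mod m"
  have inv: "(k + j) mod m = i \<longleftrightarrow> k = ?k" if "k < m" for k
  proof
    assume "(k + j) mod m = i"
    then have "?k = (k + j + (m - j)) mod m" by (metis mod_add_left_eq)
    then show "k = ?k" using that assms by simp
  next
    assume "k = ?k"
    then have "(k + j) mod m = (i + (m - j) + j) mod m" by (simp add: mod_simps)
    then show "(k + j) mod m = i" using assms by simp
  qed
  have "(M * ind_rep s (b, j)) $$ (r, i) = (\<Sum>k<m. M $$ (r, k) * ind_rep s (b, j) $$ (k, i))"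
    using assms by (auto simp: ind_rep_def scalar_prod_def atLeast0LessThan intro!: sum.cong)
  also have "\<dots> = (\<Sum>k<m. if k = ?k then M $$ (r, k) * unity_root p (s * b * a ^ k) else 0)"
    using assms inv by (intro sum.cong) (auto simp: ind_rep_def)
  also have "\<dots> = M $$ (r, ?k) * unity_root p (s * b * a ^ ?k)"
    using m_pos by simp
  also have "unity_root p (s * b * a ^ ?k) = unity_root p (s * b * a ^ (i + (m - j)))"
    by (metis mult_a_pow_mod unity_root_mod)
  finally show ?thesis .
qed

lemma lin_rep_irreducible: "irreducible_rep F 1 (lin_rep t)"
  unfolding irreducible_rep_def
proof (intro conjI allI impI)
  show "lin_rep t \<in> hom F (GL 1)"
  proof (rule hom_GL_I[OF F.is_group])
    fix x y assume "x \<in> carrier F" "y \<in> carrier F"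
    obtain b j b' j' where eqs: "x = (b, j)" "y = (b', j')" by (cases x; cases y)
    have "unity_root m (t * ((j + j') mod m)) = unity_root m (t * j) * unity_root m (t * j')"
      by (metis mod_mult_right_eq ring_distribs(1) unity_root_add unity_root_mod)
    then show "lin_rep t (x \<otimes>\<^bsub>F\<^esub> y) = lin_rep t x * lin_rep t y"
      unfolding eqs by (intro eq_matI) (auto simp: lin_rep_def scalar_prod_def)
  next
    show "lin_rep t \<one>\<^bsub>F\<^esub> = 1\<^sub>m 1" by (intro eq_matI) (auto simp: lin_rep_def)
  qed (auto simp: lin_rep_def)
  fix W assume W: "invariant_subspace F 1 (lin_rep t) W"
  show "W = {0\<^sub>v 1} \<or> W = carrier_vec 1"
  proof (rule disjCI)
    assume "W \<noteq> carrier_vec 1"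
    have "w = 0\<^sub>v 1" if w: "w \<in> W" for w
    proof (rule ccontr)
      assume "w \<noteq> 0\<^sub>v 1"
      have wc: "w \<in> carrier_vec 1" using W w by (auto simp: invariant_subspace_iff)
      with \<open>w \<noteq> 0\<^sub>v 1\<close> have w0: "w $ 0 \<noteq> 0" by (auto simp: vec_eq_iff)
      have "v \<in> W" if "v \<in> carrier_vec 1" for v
      proof -
        have "v = (v $ 0 / w $ 0) \<cdot>\<^sub>v w" using w0 that wc by (intro eq_vecI) auto
        then show ?thesis using W w unfolding invariant_subspace_iff by metis
      qed
      then have "W = carrier_vec 1" using W by (auto simp: invariant_subspace_iff)
      with \<open>W \<noteq> carrier_vec 1\<close> show False by simp
    qed
    then show "W = {0\<^sub>v 1}" using W by (auto simp: invariant_subspace_iff)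
  qed
qed simp

lemma ind_rep_hom: "ind_rep s \<in> hom F (GL m)"
proof (rule hom_GL_I[OF F.is_group])
  fix x y assume "x \<in> carrier F" "y \<in> carrier F"
  obtain b j b' j' where eqs: "x = (b, j)" "y = (b', j')" by (cases x; cases y)
  have *: "b < p" "j < m" "b' < p" "j' < m" using eqs \<open>x \<in> carrier F\<close> \<open>y \<in> carrier F\<close> by auto
  show "ind_rep s (x \<otimes>\<^bsub>F\<^esub> y) = ind_rep s x * ind_rep s y"
  proof (rule eq_matI)
    fix k i assume "k < dim_row (ind_rep s x * ind_rep s y)" "i < dim_col (ind_rep s x * ind_rep s y)"
    then have ki: "k < m" "i < m" by (auto simp: eqs ind_rep_def)
    have "(ind_rep s x * ind_rep s y) $$ (k, i)
        = (\<Sum>l<m. ind_rep s (b, j) $$ (k, l) * ind_rep s (b', j') $$ (l, i))"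
      using ki by (auto simp: eqs ind_rep_def scalar_prod_def atLeast0LessThan intro!: sum.cong)
    also have "\<dots> = (\<Sum>l<m. if l = (k + j) mod m
        then unity_root p (s * b * a ^ k) * ind_rep s (b', j') $$ (l, i) else 0)"
      using ki by (intro sum.cong) (auto simp: ind_rep_def)
    also have "\<dots> = unity_root p (s * b * a ^ k) * ind_rep s (b', j') $$ ((k + j) mod m, i)"
      using m_pos by simp
    also have "\<dots> = (if (k + j + j') mod m = i
        then unity_root p (s * b * a ^ k) * unity_root p (s * b' * a ^ ((k + j) mod m)) else 0)"
      using ki m_pos by (simp add: ind_rep_def mod_simps)
    also have "unity_root p (s * b' * a ^ ((k + j) mod m)) = unity_root p (s * b' * a ^ (k + j))"
      by (metis mult_a_pow_mod unity_root_mod)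
    also have "unity_root p (s * b * a ^ k) * unity_root p (s * b' * a ^ (k + j))
        = unity_root p (s * (b + a ^ j * b') * a ^ k)"
      by (simp add: power_add algebra_simps flip: unity_root_add)
    also have "\<dots> = unity_root p (s * ((b + a ^ j * b') mod p) * a ^ k)"
      by (intro unity_root_cong cong_mult cong_refl) (simp add: cong_def)
    finally show "ind_rep s (x \<otimes>\<^bsub>F\<^esub> y) $$ (k, i) = (ind_rep s x * ind_rep s y) $$ (k, i)"
      using ki by (simp add: eqs ind_rep_def mod_simps add.assoc)
  qed (auto simp: eqs ind_rep_def)
next
  show "ind_rep s \<one>\<^bsub>F\<^esub> = 1\<^sub>m m" by (intro eq_matI) (auto simp: ind_rep_def)
qed (auto simp: ind_rep_def)

lemma ind_rep_translation_vec:
  assumes "k < m" "w \<in> carrier_vec m"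
  shows "(ind_rep s (b, 0) *\<^sub>v w) $ k = unity_root p (s * b * a ^ k) * w $ k"
proof -
  have "(ind_rep s (b, 0) *\<^sub>v w) $ k = (\<Sum>i<m. (if k = i then unity_root p (s * b * a ^ k) else 0) * w $ i)"
    using assms by (auto simp: ind_rep_def scalar_prod_def atLeast0LessThan intro!: sum.cong)
  also have "\<dots> = (\<Sum>i<m. if i = k then unity_root p (s * b * a ^ k) * w $ i else 0)"
    by (intro sum.cong) auto
  finally show ?thesis using assms by simp
qed

lemma ind_rep_rotation_unit_vec:
  assumes "k < m" "j < m"
  shows "ind_rep s (0, j) *\<^sub>v unit_vec m ((k + j) mod m) = unit_vec m k"
proof (rule eq_vecI)
  fix l assume "l < dim_vec (unit_vec m k :: complex vec)"
  then have l: "l < m" by simp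
  have "(k + j) mod m < m" using m_pos by simp
  moreover have "(l + j) mod m = (k + j) mod m \<longleftrightarrow> l = k"
    using l assms by (metis add_diff_cancel_right' mod_less cong_add_rcancel_nat cong_def)
  ultimately show "(ind_rep s (0, j) *\<^sub>v unit_vec m ((k + j) mod m)) $ l = (unit_vec m k :: complex vec) $ l"
    using l assms by (auto simp: ind_rep_def scalar_prod_right_unit)
qed (auto simp: ind_rep_def)

lemma a_pow_mult_cong_iff:
  assumes "coprime p s"
  shows "[s * a ^ i = s * a ^ j] (mod p) \<longleftrightarrow> i mod m = j mod m"
  using assms by (simp add: cong_mult_lcancel_nat coprime_commute a_pow_cong_iff)

text \<open>The translations act on the coordinate lines by pairwise different characters, so the
  Fourier projections onto these lines preserve every invariant subspace.\<close>

lemma ind_rep_irreducible: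
  assumes s: "coprime p s"
  shows "irreducible_rep F m (ind_rep s)"
  unfolding irreducible_rep_def
proof (intro conjI allI impI ind_rep_hom m_pos)
  fix W assume inv: "invariant_subspace F m (ind_rep s) W"
  then have W: "W \<subseteq> carrier_vec m" "0\<^sub>v m \<in> W" "\<forall>v\<in>W. \<forall>w\<in>W. v + w \<in> W" "\<forall>c. \<forall>v\<in>W. c \<cdot>\<^sub>v v \<in> W"
    and act: "\<And>b j w. b < p \<Longrightarrow> j < m \<Longrightarrow> w \<in> W \<Longrightarrow> ind_rep s (b, j) *\<^sub>v w \<in> W"
    unfolding invariant_subspace_iff by auto
  note W_sum = vec_sum_in_subspace[OF W(2,3,4,1)]
  show "W = {0\<^sub>v m} \<or> W = carrier_vec m"
  proof (cases "W = {0\<^sub>v m}")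
    case False
    then obtain w where w: "w \<in> W" "w \<noteq> 0\<^sub>v m" using W(2) by blast
    then have wc: "w \<in> carrier_vec m" using W by auto
    with w obtain i where i: "i < m" "w $ i \<noteq> 0" by (auto simp: vec_eq_iff)
    \<comment> \<open>\<open>c\<close> represents -s a^i modulo \<open>p\<close>. Weighting
      translation by \<open>b\<close> with \<open>unity_root p (b * c)\<close> and summing over
      \<open>b\<close> multiplies coordinate \<open>i\<close> by \<open>p\<close> and annihilates
      all others.\<close>
    define c where "c = p - s * a ^ i mod p"
    have c: "p dvd c + s * a ^ k \<longleftrightarrow> k = i" if "k < m" for k
    proof -
      have "c + s * a ^ i mod p = p"
        using p_pos by (simp add: c_def le_add_diff_inverse2 less_imp_le)
      then have "[c + s * a ^ i = 0] (mod p)"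
        by (metis cong_def mod_0 mod_add_right_eq mod_self)
      then have "p dvd c + s * a ^ k \<longleftrightarrow> [c + s * a ^ k = c + s * a ^ i] (mod p)"
        by (metis cong_0_iff cong_sym cong_trans)
      also have "\<dots> \<longleftrightarrow> k mod m = i mod m"
        by (simp add: cong_add_lcancel_nat a_pow_mult_cong_iff[OF s])
      finally show ?thesis using that i by simp
    qed
    define u where "u = vec m (\<lambda>k. \<Sum>b<p. unity_root p (b * c) * (ind_rep s (b, 0) *\<^sub>v w) $ k)"
    have uW: "u \<in> W"
      unfolding u_def using act w m_pos by (intro W_sum) auto
    have u_eq: "u = (of_nat p * w $ i) \<cdot>\<^sub>v unit_vec m i"
    proof (rule eq_vecI)
      fix k assume "k < dim_vec ((of_nat p * w $ i) \<cdot>\<^sub>v unit_vec m i)"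
      then have k: "k < m" by simp
      have "u $ k = (\<Sum>b<p. unity_root p (b * (c + s * a ^ k)) * w $ k)"
        using k wc unfolding u_def
        by (auto simp: ind_rep_translation_vec ring_distribs unity_root_add mult_ac intro!: sum.cong)
      also have "\<dots> = (\<Sum>b<p. unity_root p (b * (c + s * a ^ k))) * w $ k"
        by (rule sum_distrib_right[symmetric])
      also have "\<dots> = (if k = i then of_nat p else 0) * w $ k"
        using k by (simp add: sum_unity_root[OF p_pos] c)
      finally show "u $ k = ((of_nat p * w $ i) \<cdot>\<^sub>v unit_vec m i) $ k"
        using k i by simp
    qed (simp add: u_def)
    have "inverse (of_nat p * w $ i) \<cdot>\<^sub>v u = unit_vec m i"
      unfolding u_eq using i p_pos by (intro eq_vecI) (auto simp: field_simps)
    then have ei: "unit_vec m i \<in> W" using W(4) uW by metis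
    \<comment> \<open>The rotation by i - k carries the line of coordinate \<open>i\<close> to that
      of coordinate \<open>k\<close>.\<close>
    have ek: "unit_vec m k \<in> W" if k: "k < m" for k
    proof -
      define j where "j = (i + (m - k)) mod m"
      have "j < m" using m_pos by (simp add: j_def)
      moreover have "(k + j) mod m = i" using k i by (simp add: j_def mod_simps)
      ultimately show ?thesis
        using act[of 0 j "unit_vec m i"] ind_rep_rotation_unit_vec[OF k, of j s] ei p_pos by simp
    qed
    have "v \<in> W" if v: "v \<in> carrier_vec m" for v
    proof -
      have "vec m (\<lambda>l. \<Sum>k<m. v $ k * unit_vec m k $ l) \<in> W"
        using ek by (intro W_sum) auto
      moreover have "vec m (\<lambda>l. \<Sum>k<m. v $ k * unit_vec m k $ l) = v"
        using v by (intro eq_vecI) (auto simp: unit_vec_def if_distrib cong: if_cong)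
      ultimately show ?thesis by simp
    qed
    then show ?thesis using W(1) by blast
  qed simp
qed

end

section \<open>The irreducible characters of the affine group\<close>

lemma (in mat_rep) rep_pow_eigenvec:
  assumes "x \<in> carrier G" "v \<in> carrier_vec n" "\<rho> x *\<^sub>v v = z \<cdot>\<^sub>v v"
  shows "\<rho> (x [^] (k::nat)) *\<^sub>v v = z ^ k \<cdot>\<^sub>v v"
proof (induction k)
  case (Suc k)
  have "\<rho> (x [^] Suc k) *\<^sub>v v = \<rho> (x [^] k) *\<^sub>v (z \<cdot>\<^sub>v v)"
    using assms by (simp add: rep_vec_mult)
  also have "\<dots> = z \<cdot>\<^sub>v (z ^ k \<cdot>\<^sub>v v)"
    using assms Suc by (simp add: mult_mat_vec[of _ n n])
  finally show ?case by (simp add: smult_smult_assoc)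
qed (use assms in simp)

lemma (in irred_rep) ex_eigenvec:
  assumes "x \<in> carrier G"
  obtains v z where "v \<in> carrier_vec n" "v \<noteq> 0\<^sub>v n" "\<rho> x *\<^sub>v v = z \<cdot>\<^sub>v v"
  using spectrum_non_empty[OF rep_carrier[OF assms] dim_pos] assms that
  by (auto simp: spectrum_def eigenvalue_def eigenvector_def)

context affine
begin

lemma coprime_p: "s \<in> {1..<p} \<Longrightarrow> coprime p s"
  using p by (intro prime_imp_coprime) (auto dest: dvd_imp_le)

lemma translation_pow: "(1, 0) [^]\<^bsub>F\<^esub> (k::nat) = (k mod p, 0)"
  by (induction k) (auto simp: mod_simps)

lemma rotation_pow: "(0, 1 mod m) [^]\<^bsub>F\<^esub> (k::nat) = (0, k mod m)"
  by (induction k) (auto simp: mod_simps)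

text \<open>Let \<open>v\<close> be an eigenvector of translation by 1, with eigenvalue
  \<open>unity_root p s\<close>. If s = 0, all translations act trivially, so an eigenvector of the
  generating rotation spans the image of an intertwiner from some \<open>lin_rep t\<close>.
  Otherwise the rotated copies of \<open>v\<close> give an intertwiner from
  \<open>ind_rep s\<close>; this is Frobenius reciprocity made explicit.\<close>

lemma irreducible_rep_cases:
  assumes irr: "irreducible_rep F n \<rho>"
  shows "(\<exists>t<m. rep_character F n \<rho> = rep_character F 1 (lin_rep t)) \<or>
    (\<exists>s\<in>{1..<p}. rep_character F n \<rho> = rep_character F m (ind_rep s))"
proof -
  interpret irred_rep F n \<rho> by (rule F.irred_repI) fact
  have T: "(1, 0) \<in> carrier F" using p_gt_1 m_pos by simp
  \<comment> \<open>The reduction \<open>1 mod m\<close> covers m = 1, where the only exponent is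
    0.\<close>
  have R: "(0, 1 mod m) \<in> carrier F" using p_pos m_pos by simp
  obtain v z where v: "v \<in> carrier_vec n" "v \<noteq> 0\<^sub>v n" and z: "\<rho> (1, 0) *\<^sub>v v = z \<cdot>\<^sub>v v"
    using ex_eigenvec[OF T] .
  have z_act: "\<rho> (b mod p, 0) *\<^sub>v v = z ^ b \<cdot>\<^sub>v v" for b
    using rep_pow_eigenvec[OF T v(1) z, of b] unfolding translation_pow .
  have "z ^ p = 1"
    using z_act[of p] v rep_one by (auto simp: vec_eq_iff)
  then obtain s where s: "s < p" "z = unity_root p s" using ex_unity_root[OF p_pos] by blast
  have s_act: "\<rho> (b mod p, 0) *\<^sub>v v = unity_root p (s * b) \<cdot>\<^sub>v v" for b
    using z_act[of b] by (simp add: s unity_root_power mult.commute)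
  show ?thesis
  proof (cases "s = 0")
    case True
    have "\<rho> k *\<^sub>v v = v" if k: "k \<in> translations" for k
    proof -
      obtain b where "b < p" "k = (b, 0)" using k by (auto simp: translations_eq)
      then show ?thesis using s_act[of b] True v by simp
    qed
    then have triv: "\<rho> (b, 0) = 1\<^sub>m n" if "b < p" for b
      using that by (intro normal_fixed_vec_imp_trivial[OF translations_normal v]) (auto simp: translations_eq)
    obtain u y where u: "u \<in> carrier_vec n" "u \<noteq> 0\<^sub>v n" and y: "\<rho> (0, 1 mod m) *\<^sub>v u = y \<cdot>\<^sub>v u"
      using ex_eigenvec[OF R] .
    have y_act: "\<rho> (0, j mod m) *\<^sub>v u = y ^ j \<cdot>\<^sub>v u" for j
      using rep_pow_eigenvec[OF R u(1) y, of j] unfolding rotation_pow .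
    have "y ^ m = 1"
      using y_act[of m] u rep_one by (auto simp: vec_eq_iff)
    then obtain t where t: "t < m" "y = unity_root m t" using ex_unity_root[OF m_pos] by blast
    define M where "M = mat n 1 (\<lambda>(r, _). u $ r)"
    have "rep_character F n \<rho> = rep_character F 1 (lin_rep t)"
    proof (rule intertwiner_rep_character_eq[OF F.is_group irr lin_rep_irreducible])
      show "M \<in> carrier_mat n 1" by (simp add: M_def)
      show "M \<noteq> 0\<^sub>m n 1"
      proof
        assume "M = 0\<^sub>m n 1"
        then have "u $ r = 0" if "r < n" for r using that by (auto simp: M_def mat_eq_iff)
        with u show False by (auto simp: vec_eq_iff)
      qed
      fix g assume g: "g \<in> carrier F"
      obtain b j where bj: "g = (b, j)" by (cases g)
      have *: "b < p" "j < m" using g bj by auto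
      have "\<rho> g *\<^sub>v u = \<rho> ((b, 0) \<otimes>\<^bsub>F\<^esub> (0, j)) *\<^sub>v u" using * bj by simp
      also have "\<dots> = \<rho> (b, 0) *\<^sub>v (\<rho> (0, j) *\<^sub>v u)"
        using * u m_pos p_pos by (intro rep_vec_mult) auto
      also have "\<dots> = unity_root m (t * j) \<cdot>\<^sub>v u"
        using * u y_act[of j] by (simp add: triv t unity_root_power mult.commute)
      finally have act: "\<rho> g *\<^sub>v u = unity_root m (t * j) \<cdot>\<^sub>v u" .
      show "M * lin_rep t g = \<rho> g * M"
      proof (rule eq_matI)
        fix r i assume "r < dim_row (\<rho> g * M)" "i < dim_col (\<rho> g * M)"
        then have ri: "r < n" "i = 0" using g by (auto simp: M_def)
        have "(\<rho> g * M) $$ (r, i) = (\<rho> g *\<^sub>v u) $ r"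
          using ri g u by (simp add: M_def scalar_prod_def)
        also have "\<dots> = (M * lin_rep t g) $$ (r, i)"
          unfolding act using ri u by (simp add: M_def bj lin_rep_def scalar_prod_def)
        finally show "(M * lin_rep t g) $$ (r, i) = (\<rho> g * M) $$ (r, i)" by simp
      qed (use g in \<open>auto simp: M_def bj lin_rep_def\<close>)
    qed
    with t show ?thesis by blast
  next
    case False
    then have s1: "s \<in> {1..<p}" using s by auto
    then have cop: "coprime p s" by (rule coprime_p)
    \<comment> \<open>Column \<open>i\<close> is \<open>v\<close> rotated by -i, because
      \<open>ind_rep s\<close> at rotation -i sends the unit vector of index 0 to that of index
      \<open>i\<close>. Column 0 is \<open>v\<close> itself, so \<open>M\<close> is nonzero.\<close>
    define M where "M = mat n m (\<lambda>(r, i). (\<rho> (0, (m - i) mod m) *\<^sub>v v) $ r)"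
    have "rep_character F n \<rho> = rep_character F m (ind_rep s)"
    proof (rule intertwiner_rep_character_eq[OF F.is_group irr ind_rep_irreducible[OF cop]])
      show "M \<in> carrier_mat n m" by (simp add: M_def)
      show "M \<noteq> 0\<^sub>m n m"
      proof
        assume "M = 0\<^sub>m n m"
        then have "M $$ (r, 0) = 0" if "r < n" for r using that m_pos by simp
        then have "v $ r = 0" if "r < n" for r using that m_pos v rep_one by (simp add: M_def)
        with v show False by (auto simp: vec_eq_iff)
      qed
      fix g assume g: "g \<in> carrier F"
      obtain b j where bj: "g = (b, j)" by (cases g)
      have *: "b < p" "j < m" using g bj by auto
      show "M * ind_rep s g = \<rho> g * M"
      proof (rule eq_matI)
        fix r i assume "r < dim_row (\<rho> g * M)" "i < dim_col (\<rho> g * M)"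
        then have ri: "r < n" "i < m" using g by (auto simp: M_def)
        \<comment> \<open>Here \<open>k\<close> is i - j modulo \<open>m\<close> and
          \<open>b'\<close> represents b a^(i - j). They are chosen so that (b, j) (0, -i) = (0, -k)
          (b', 0), which puts the translation next to its eigenvector \<open>v\<close>.\<close>
        define k where "k = (i + (m - j)) mod m"
        define b' where "b' = b * a ^ (i + (m - j))"
        have k: "k < m" using m_pos by (simp add: k_def)
        have km: "(m - k) mod m = (j + (m - i)) mod m"
        proof -
          have "[k + (j + (m - i)) = 2 * m] (mod m)"
          proof -
            have "[k + (j + (m - i)) = i + (m - j) + (j + (m - i))] (mod m)"
              unfolding k_def by (intro cong_add cong_refl) (simp add: cong_def)
            then show ?thesis using * ri by (simp add: mult_2)
          qed
          moreover have "[k + (m - k) = 2 * m] (mod m)" using k by (simp add: cong_def)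
          ultimately show ?thesis
            by (metis cong_add_lcancel_nat cong_def)
        qed
        have "\<rho> g *\<^sub>v (\<rho> (0, (m - i) mod m) *\<^sub>v v) = \<rho> (g \<otimes>\<^bsub>F\<^esub> (0, (m - i) mod m)) *\<^sub>v v"
          using g v m_pos p_pos by (intro rep_vec_mult[symmetric]) auto
        also have "g \<otimes>\<^bsub>F\<^esub> (0, (m - i) mod m) = (0, (m - k) mod m) \<otimes>\<^bsub>F\<^esub> (b' mod p, 0)"
        proof -
          have "(a ^ ((m - k) mod m) * (b' mod p)) mod p = (b' * a ^ ((j + (m - i)) mod m)) mod p"
            by (simp add: km mod_simps mult.commute)
          also have "\<dots> = (b' * a ^ (j + (m - i))) mod p" by (rule mult_a_pow_mod)
          also have "b' * a ^ (j + (m - i)) = b * a ^ (2 * m)"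
            using * ri by (simp add: b'_def mult.assoc mult_2 flip: power_add)
          also have "\<dots> mod p = (b * a ^ (2 * m mod m)) mod p" by (rule mult_a_pow_mod[symmetric])
          finally show ?thesis using * by (simp add: bj km mod_simps)
        qed
        also have "\<rho> \<dots> *\<^sub>v v = \<rho> (0, (m - k) mod m) *\<^sub>v (\<rho> (b' mod p, 0) *\<^sub>v v)"
          using v m_pos p_pos by (intro rep_vec_mult) auto
        also have "\<dots> = unity_root p (s * b') \<cdot>\<^sub>v (\<rho> (0, (m - k) mod m) *\<^sub>v v)"
          using v m_pos p_pos by (simp add: s_act mult_mat_vec[of _ n n])
        finally have act: "\<rho> g *\<^sub>v (\<rho> (0, (m - i) mod m) *\<^sub>v v)
          = unity_root p (s * b') \<cdot>\<^sub>v (\<rho> (0, (m - k) mod m) *\<^sub>v v)" .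
        have dims: "dim_vec (\<rho> (0, (m - l) mod m) *\<^sub>v v) = n" for l
          using m_pos p_pos by simp
        have "(\<rho> g * M) $$ (r, i) = (\<rho> g *\<^sub>v (\<rho> (0, (m - i) mod m) *\<^sub>v v)) $ r"
          using ri g dims[of i] by (simp add: M_def scalar_prod_def)
        also have "\<dots> = M $$ (r, k) * unity_root p (s * b')"
          unfolding act using ri k dims[of k] by (simp add: M_def)
        also have "\<dots> = (M * ind_rep s g) $$ (r, i)"
          unfolding bj using ri *
          by (subst ind_rep_mult_index) (auto simp: M_def k_def b'_def mult.assoc)
        finally show "(M * ind_rep s g) $$ (r, i) = (\<rho> g * M) $$ (r, i)" by simp
      qed (use g in \<open>auto simp: M_def bj ind_rep_def\<close>)
    qed
    with s1 show ?thesis by blast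
  qed
qed

section \<open>Counting the irreducible characters of the affine group\<close>

abbreviation "lin_char t \<equiv> rep_character F 1 (lin_rep t)"
abbreviation "ind_char s \<equiv> rep_character F m (ind_rep s)"

lemma Irr_F: "Irr F = lin_char ` {..<m} \<union> ind_char ` {1..<p}"
proof (intro equalityI subsetI)
  fix \<chi> assume "\<chi> \<in> Irr F"
  then show "\<chi> \<in> lin_char ` {..<m} \<union> ind_char ` {1..<p}"
    unfolding Irr_def using irreducible_rep_cases by blast
next
  fix \<chi> assume "\<chi> \<in> lin_char ` {..<m} \<union> ind_char ` {1..<p}"
  then show "\<chi> \<in> Irr F"
    unfolding Irr_def using lin_rep_irreducible ind_rep_irreducible[OF coprime_p] by blast
qed

lemma lin_char: "b < p \<Longrightarrow> j < m \<Longrightarrow> lin_char t (b, j) = unity_root m (t * j)"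
  by (simp add: rep_character_def lin_rep_def)

lemma ind_char:
  assumes "b < p" "j < m"
  shows "ind_char s (b, j) = (if j = 0 then \<Sum>k<m. unity_root p (s * b * a ^ k) else 0)"
proof -
  have "(k + j) mod m = k \<longleftrightarrow> j = 0" if "k < m" for k
    using that assms by (cases "k + j < m") (auto simp: le_mod_geq)
  then show ?thesis using assms by (auto simp: rep_character_def ind_rep_def intro!: sum.cong sum.neutral)
qed

text \<open>Restricted to the translations, \<open>ind_char s\<close> is the sum of the characters
  with parameters s a^k. The coefficient at \<open>c\<close> counts how often -c occurs among them,
  so the character determines the orbit of \<open>s\<close> under multiplication by powers of
  \<open>a\<close>.\<close>

lemma ind_char_fourier:
  "(\<Sum>b<p. ind_char s (b, 0) * unity_root p (b * c)) = of_nat (p * card {k\<in>{..<m}. p dvd c + s * a ^ k})"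
proof -
  have "(\<Sum>b<p. ind_char s (b, 0) * unity_root p (b * c))
      = (\<Sum>b<p. \<Sum>k<m. unity_root p (b * (c + s * a ^ k)))"
  proof (rule sum.cong)
    fix b assume "b \<in> {..<p}"
    then have "ind_char s (b, 0) * unity_root p (b * c)
        = (\<Sum>k<m. unity_root p (s * b * a ^ k) * unity_root p (b * c))"
      using m_pos by (simp add: ind_char sum_distrib_right)
    also have "\<dots> = (\<Sum>k<m. unity_root p (b * (c + s * a ^ k)))"
      by (simp add: algebra_simps flip: unity_root_add)
    finally show "ind_char s (b, 0) * unity_root p (b * c) = (\<Sum>k<m. unity_root p (b * (c + s * a ^ k)))" .
  qed simp
  also have "\<dots> = (\<Sum>k<m. \<Sum>b<p. unity_root p (b * (c + s * a ^ k)))"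
    by (rule sum.swap)
  also have "\<dots> = (\<Sum>k<m. if p dvd c + s * a ^ k then of_nat p else 0)"
    by (simp add: sum_unity_root[OF p_pos])
  also have "\<dots> = of_nat (p * card {k\<in>{..<m}. p dvd c + s * a ^ k})"
    by (simp add: sum.If_cases Int_def mult.commute)
  finally show ?thesis .
qed

lemma ind_char_eq_iff:
  assumes s: "s \<in> {1..<p}" "s' \<in> {1..<p}"
  shows "ind_char s' = ind_char s \<longleftrightarrow> s' \<in> (\<lambda>k. s * a ^ k mod p) ` {..<m}"
proof
  assume eq: "ind_char s' = ind_char s"
  \<comment> \<open>The frequency \<open>p - s'\<close> stands for -s'. The index 0 shows that
    \<open>ind_char s'\<close> has a nonzero coefficient there, hence so does
    \<open>ind_char s\<close>.\<close>
  have "0 \<in> {k\<in>{..<m}. p dvd (p - s') + s' * a ^ k}" using s m_pos by simp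
  then have "card {k\<in>{..<m}. p dvd (p - s') + s' * a ^ k} \<noteq> 0" by auto
  then have "card {k\<in>{..<m}. p dvd (p - s') + s * a ^ k} \<noteq> 0"
    using ind_char_fourier[of s' "p - s'", unfolded eq, unfolded ind_char_fourier[of s] of_nat_eq_iff] p_pos
    by auto
  then obtain k where k: "k < m" "p dvd (p - s') + s * a ^ k"
    by (metis (mono_tags, lifting) Collect_empty_eq card.empty lessThan_iff)
  then have "[(p - s') + s * a ^ k = 0] (mod p)" by (simp only: cong_0_iff)
  also have "[0 = (p - s') + s'] (mod p)" using s by (simp add: cong_def)
  finally have "[s * a ^ k = s'] (mod p)" by (simp only: cong_add_lcancel_nat)
  then have "s' = s * a ^ k mod p" using s by (simp add: cong_def)
  with k show "s' \<in> (\<lambda>k. s * a ^ k mod p) ` {..<m}" by blast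
next
  assume "s' \<in> (\<lambda>k. s * a ^ k mod p) ` {..<m}"
  then obtain k where k: "s' = s * a ^ k mod p" by blast
  \<comment> \<open>Replacing \<open>s\<close> by s a^k only shifts the summation index
    cyclically.\<close>
  have bij: "bij_betw (\<lambda>l. (l + k) mod m) {..<m} {..<m}"
  proof -
    have "inj_on (\<lambda>l. (l + k) mod m) {..<m}"
      by (rule inj_onI) (metis cong_add_rcancel_nat cong_def lessThan_iff mod_less)
    moreover have "(\<lambda>l. (l + k) mod m) ` {..<m} \<subseteq> {..<m}" using m_pos by auto
    ultimately show ?thesis by (simp add: bij_betw_def endo_inj_surj)
  qed
  show "ind_char s' = ind_char s"
  proof (rule extensionalityI[of _ "carrier F"])
    fix x assume x: "x \<in> carrier F"
    obtain b j where bj: "x = (b, j)" by (cases x)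
    have "(\<Sum>l<m. unity_root p (s' * b * a ^ l)) = (\<Sum>l<m. unity_root p (s * b * a ^ ((l + k) mod m)))"
    proof (rule sum.cong)
      fix l
      have "unity_root p (s' * b * a ^ l) = unity_root p (s * a ^ k * b * a ^ l)"
        unfolding k by (intro unity_root_cong cong_mult cong_refl) (simp add: cong_def)
      also have "\<dots> = unity_root p (s * b * a ^ (l + k))" by (simp add: power_add mult_ac)
      also have "\<dots> = unity_root p (s * b * a ^ ((l + k) mod m))" by (metis mult_a_pow_mod unity_root_mod)
      finally show "unity_root p (s' * b * a ^ l) = unity_root p (s * b * a ^ ((l + k) mod m))" .
    qed simp
    also have "\<dots> = (\<Sum>l<m. unity_root p (s * b * a ^ l))"
      using sum.reindex_bij_betw[OF bij, of "\<lambda>l. unity_root p (s * b * a ^ l)"] .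
    finally show "ind_char s' x = ind_char s x" using x by (simp add: bj ind_char)
  qed (auto simp: rep_character_def)
qed

text \<open>The fibre is the orbit of \<open>s\<close> under the powers of \<open>a\<close>, which
  act freely on the nonzero residues and form a group of order \<open>m\<close>.\<close>

lemma card_ind_char_fibre:
  assumes s: "s \<in> {1..<p}"
  shows "card {s'\<in>{1..<p}. ind_char s' = ind_char s} = m"
proof -
  have "s * a ^ k mod p \<in> {1..<p}" for k
  proof -
    have "coprime p (s * a ^ k)" using coprime_p[OF s] coprime_a_pow by simp
    then have "s * a ^ k mod p \<noteq> 0"
      using p_gt_1 by (metis coprime_absorb_left dvd_eq_mod_eq_0 nat_dvd_1_iff_1 less_irrefl)
    then show ?thesis using p_pos by simp
  qed
  then have "{s'\<in>{1..<p}. ind_char s' = ind_char s} = (\<lambda>k. s * a ^ k mod p) ` {..<m}"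
    using ind_char_eq_iff[OF s] by blast
  moreover have "inj_on (\<lambda>k. s * a ^ k mod p) {..<m}"
    by (rule inj_onI) (use a_pow_mult_cong_iff[OF coprime_p[OF s]] in \<open>auto simp: cong_def\<close>)
  ultimately show ?thesis by (simp add: card_image)
qed

text \<open>The p - 1 parameters \<open>s\<close> fall into fibres of size \<open>m\<close>. The two
  families are disjoint because summing a character over the translations gives \<open>p\<close> for
  \<open>lin_char\<close> and 0 for \<open>ind_char\<close>.\<close>

lemma card_Irr_F: "card (Irr F) = m + (p - 1) div m"
proof -
  have "p - 1 = (\<Sum>s\<in>{1..<p}. 1)" by simp
  also have "\<dots> = (\<Sum>\<chi>\<in>ind_char ` {1..<p}. \<Sum>s\<in>{s\<in>{1..<p}. ind_char s = \<chi>}. 1)"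
    by (rule sum.image_gen) simp
  also have "\<dots> = (\<Sum>\<chi>\<in>ind_char ` {1..<p}. m)"
  proof (rule sum.cong)
    fix \<chi> assume "\<chi> \<in> ind_char ` {1..<p}"
    then obtain s where "s \<in> {1..<p}" "\<chi> = ind_char s" by blast
    then show "(\<Sum>s\<in>{s\<in>{1..<p}. ind_char s = \<chi>}. 1) = m"
      using card_ind_char_fibre[of s] by (simp only: card_eq_sum[symmetric])
  qed simp
  finally have ind: "card (ind_char ` {1..<p}) = (p - 1) div m" using m_pos by simp
  have "inj_on lin_char {..<m}"
  proof (rule inj_onI)
    fix t t' assume t: "t \<in> {..<m}" "t' \<in> {..<m}" "lin_char t = lin_char t'"
    show "t = t'"
    \<comment> \<open>For m > 1 the value at the rotation (0, 1) determines \<open>t\<close>; for m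
      = 1 this pair is not in the carrier, but then only t = 0 is left.\<close>
    proof (cases "m = 1")
      case False
      then have "unity_root m t = unity_root m t'"
        using fun_cong[OF t(3), of "(0, 1)"] lin_char[of 0 1 t] lin_char[of 0 1 t'] p_pos m_pos by simp
      then show ?thesis
        using t bij_betw_imp_inj_on[OF bij_betw_roots_unity[OF m_pos]]
        by (auto simp: unity_root_def inj_on_def)
    qed (use t in simp)
  qed
  then have lin: "card (lin_char ` {..<m}) = m" by (simp add: card_image)
  have "lin_char ` {..<m} \<inter> ind_char ` {1..<p} = {}"
  proof (rule ccontr)
    assume "lin_char ` {..<m} \<inter> ind_char ` {1..<p} \<noteq> {}"
    then obtain t s where ts: "s \<in> {1..<p}" "lin_char t = ind_char s" by blast
    have "\<not> p dvd s * a ^ k" for k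
      using coprime_p[OF ts(1)] coprime_a_pow[of k] p_gt_1
      by (metis coprime_absorb_left coprime_mult_right_iff nat_dvd_1_iff_1 less_irrefl)
    then have "(\<Sum>b<p. ind_char s (b, 0)) = 0" using ind_char_fourier[of s 0] by simp
    moreover have "(\<Sum>b<p. lin_char t (b, 0)) = of_nat p" using m_pos by (simp add: lin_char[simplified])
    ultimately show False using ts p_pos by simp
  qed
  then show ?thesis unfolding Irr_F using lin ind by (simp add: card_Un_disjoint)
qed

lemma card_Irr_p'_F: "card (Irr_p' p F) = m + (p - 1) div m"
proof -
  have "m dvd p - 1" using order_divides_totient[OF coprime_a] p by (simp add: ord_a totient_prime)
  then have "m < p" using p_gt_1 by (auto dest!: dvd_imp_le)
  then have "coprime m p" using coprime_p[of m] m_pos by (simp add: coprime_commute)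
  then have "Irr F \<subseteq> Irr_p' p F"
    unfolding Irr_F Irr_p'_eq[OF F.is_group]
    using lin_rep_irreducible ind_rep_irreducible[OF coprime_p] coprime_1_left[of p] by blast
  then have "Irr_p' p F = Irr F" by (auto simp: Irr_p'_def)
  then show ?thesis by (simp add: card_Irr_F)
qed

end

section \<open>Extensions by a fixed-point-free module\<close>

lemma (in comm_group) solvable: "solvable G"
  unfolding solvable_def
  using augment_solvable_seq[OF subgroup_self] derived_eq_singleton[OF subset_refl]
  by (simp add: solvable_seq.unity)

lemma (in group_hom) solvable_if_abelian_kernel:
  assumes "h ` carrier G = carrier H" "solvable H"
    and comm: "\<And>x y. x \<in> kernel G H h \<Longrightarrow> y \<in> kernel G H h \<Longrightarrow> x \<otimes> y = y \<otimes> x"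
  shows "solvable G"
proof -
  let ?K = "G\<lparr>carrier := kernel G H h\<rparr>"
  have K: "group ?K" by (rule G.subgroup_imp_group[OF subgroup_kernel])
  interpret K: comm_group ?K
    by (rule group.group_comm_groupI[OF K]) (simp add: comm)
  have "group_hom ?K G id"
    using K subgroup.subset[OF subgroup_kernel]
    by (auto simp: group_hom_def group_hom_axioms_def hom_def)
  then show ?thesis
    using solvable_condition[of ?K G id H h] group_hom_axioms K.solvable assms(1,2) by simp
qed

text \<open>In \<open>ext_group q\<close>, a pair \<open>(f, x)\<close> stands for the permutation \<open>(t, u) \<mapsto> (x t, u + f t)\<close> of
  \<open>{..<p} \<times> {..<q}\<close>.\<close>

context affine
begin

definition act :: "nat \<times> nat \<Rightarrow> nat \<Rightarrow> nat" where
  "act = (\<lambda>(b, j) t. (b + a ^ j * t) mod p)"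

lemma act_less [simp]: "act x t < p"
  using p_pos by (cases x) (simp add: act_def)

lemma act_one [simp]: "t < p \<Longrightarrow> act (0, 0) t = t"
  by (simp add: act_def)

lemma act_mult: "act (x \<otimes>\<^bsub>F\<^esub> y) t = act x (act y t)"
proof -
  obtain b j b' j' where eqs: "x = (b, j)" "y = (b', j')" by (cases x; cases y)
  have "((b + a ^ j * b') mod p + a ^ ((j + j') mod m) * t) mod p
      = (b + a ^ j * b' + t * a ^ ((j + j') mod m)) mod p"
    by (simp add: mod_simps mult.commute)
  also have "\<dots> = (b + a ^ j * b' + t * a ^ (j + j')) mod p"
    by (metis mult_a_pow_mod mod_add_right_eq)
  also have "b + a ^ j * b' + t * a ^ (j + j') = b + a ^ j * (b' + a ^ j' * t)"
    by (simp add: power_add algebra_simps)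
  also have "\<dots> mod p = (b + a ^ j * ((b' + a ^ j' * t) mod p)) mod p"
    by (metis mod_add_right_eq mod_mult_right_eq)
  finally show ?thesis by (simp add: act_def eqs)
qed

lemma bij_betw_act:
  assumes "x \<in> carrier F"
  shows "bij_betw (act x) {..<p} {..<p}"
proof -
  have "act (inv\<^bsub>F\<^esub> x) (act x t) = t" if "t < p" for t
    using assms that by (simp flip: act_mult)
  then have "inj_on (act x) {..<p}" by (metis inj_onI lessThan_iff)
  then show ?thesis by (simp add: bij_betw_def endo_inj_surj image_subset_iff)
qed

text \<open>Values are reduced below \<open>q\<close> and the functions are extensional, so each
  element of the module has exactly one representative.\<close>

definition sum_zero :: "nat \<Rightarrow> (nat \<Rightarrow> nat) set" where
  "sum_zero q = {f \<in> {..<p} \<rightarrow>\<^sub>E {..<q}. q dvd (\<Sum>t<p. f t)}"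

definition ext_group :: "nat \<Rightarrow> ((nat \<Rightarrow> nat) \<times> (nat \<times> nat)) monoid" where
  "ext_group q =
     \<lparr>carrier = sum_zero q \<times> carrier F,
      monoid.mult = (\<lambda>(f, x) (g, y). (\<lambda>t\<in>{..<p}. (g t + f (act y t)) mod q, x \<otimes>\<^bsub>F\<^esub> y)),
      one = (\<lambda>t\<in>{..<p}. 0, \<one>\<^bsub>F\<^esub>)\<rparr>"

lemma finite_sum_zero: "finite (sum_zero q)"
  unfolding sum_zero_def by (rule finite_subset[OF _ finite_PiE[of "{..<p}" "\<lambda>_. {..<q}"]]) auto

lemma sum_zero_mod:
  assumes "q > 0" "q dvd (\<Sum>t<p. f t)"
  shows "(\<lambda>t\<in>{..<p}. f t mod q) \<in> sum_zero q"
proof -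
  have "(\<Sum>t<p. (\<lambda>t\<in>{..<p}. f t mod q) t) mod q = (\<Sum>t<p. f t) mod q"
    by (simp add: mod_sum_eq)
  then show ?thesis using assms by (auto simp: sum_zero_def)
qed

lemma sum_zero_act: "x \<in> carrier F \<Longrightarrow> f \<in> sum_zero q \<Longrightarrow> q dvd (\<Sum>t<p. f (act x t))"
  by (simp add: sum.reindex_bij_betw[OF bij_betw_act, of x f] sum_zero_def)

end

section \<open>The group structure of the extension and its fixed-point-free translations\<close>

locale affine_ext = affine +
  fixes q :: nat
  assumes q_pos: "q > 0" and coprime_pq: "coprime p q"
begin

abbreviation "G \<equiv> ext_group q"

lemma G_carrier [simp]: "(f, x) \<in> carrier G \<longleftrightarrow> f \<in> sum_zero q \<and> x \<in> carrier F"
  by (simp add: ext_group_def)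

lemma G_mult [simp]:
  "(f, x) \<otimes>\<^bsub>G\<^esub> (g, y) = (\<lambda>t\<in>{..<p}. (g t + f (act y t)) mod q, x \<otimes>\<^bsub>F\<^esub> y)"
  by (simp add: ext_group_def)

lemma G_one [simp]: "\<one>\<^bsub>G\<^esub> = (\<lambda>t\<in>{..<p}. 0, \<one>\<^bsub>F\<^esub>)"
  by (simp add: ext_group_def)

lemma finite_G: "finite (carrier G)"
  by (simp add: ext_group_def finite_sum_zero finite_F)

lemma zero_in_sum_zero: "(\<lambda>t\<in>{..<p}. 0) \<in> sum_zero q"
  using q_pos by (auto simp: sum_zero_def)

lemma sum_zero_less: "f \<in> sum_zero q \<Longrightarrow> t < p \<Longrightarrow> f t < q"
  by (auto simp: sum_zero_def)

lemma sum_zero_eqI: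
  assumes "f \<in> sum_zero q" "g \<in> sum_zero q" "\<And>t. t < p \<Longrightarrow> f t = g t"
  shows "f = g"
  using assms by (intro PiE_ext[of f "{..<p}" "\<lambda>_. {..<q}" g]) (auto simp: sum_zero_def)

lemma G_mult_closed:
  assumes "f \<in> sum_zero q" "g \<in> sum_zero q" "y \<in> carrier F"
  shows "(\<lambda>t\<in>{..<p}. (g t + f (act y t)) mod q) \<in> sum_zero q"
  using assms q_pos sum_zero_act[of y f q]
  by (intro sum_zero_mod) (auto simp: sum.distrib sum_zero_def)

sublocale G: group G
proof (rule groupI)
  show "\<one>\<^bsub>G\<^esub> \<in> carrier G" using zero_in_sum_zero F.one_closed by simp
next
  fix u v assume "u \<in> carrier G" "v \<in> carrier G"
  then show "u \<otimes>\<^bsub>G\<^esub> v \<in> carrier G"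
    by (cases u; cases v) (auto simp: G_mult_closed simp del: F_mult F_carrier)
next
  fix u assume u: "u \<in> carrier G"
  obtain f x where eqs: "u = (f, x)" by (cases u)
  have "(\<lambda>t\<in>{..<p}. (f t + (\<lambda>t\<in>{..<p}. 0) (act x t)) mod q) = f"
    using u eqs sum_zero_less[of f] by (auto simp: sum_zero_def PiE_def extensional_def fun_eq_iff)
  then show "\<one>\<^bsub>G\<^esub> \<otimes>\<^bsub>G\<^esub> u = u" using u eqs F.l_one[of x] by simp
next
  fix u v w assume "u \<in> carrier G" "v \<in> carrier G" "w \<in> carrier G"
  obtain f x g y h z where eqs: "u = (f, x)" "v = (g, y)" "w = (h, z)" by (cases u; cases v; cases w)
  have "x \<otimes>\<^bsub>F\<^esub> y \<otimes>\<^bsub>F\<^esub> z = x \<otimes>\<^bsub>F\<^esub> (y \<otimes>\<^bsub>F\<^esub> z)"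
    using eqs \<open>u \<in> carrier G\<close> \<open>v \<in> carrier G\<close> \<open>w \<in> carrier G\<close>
    by (intro F.m_assoc) (simp_all del: F_carrier)
  then show "u \<otimes>\<^bsub>G\<^esub> v \<otimes>\<^bsub>G\<^esub> w = u \<otimes>\<^bsub>G\<^esub> (v \<otimes>\<^bsub>G\<^esub> w)"
    unfolding eqs by (auto simp: act_mult mod_simps add_ac fun_eq_iff simp del: F_mult)
next
  fix u assume u: "u \<in> carrier G"
  obtain f x where eqs: "u = (f, x)" by (cases u)
  have f: "f \<in> sum_zero q" and x: "x \<in> carrier F" using u eqs by auto
  define x' where "x' = inv\<^bsub>F\<^esub> x"
  have x': "x' \<in> carrier F" "x' \<otimes>\<^bsub>F\<^esub> x = \<one>\<^bsub>F\<^esub>" using x by (auto simp: x'_def simp del: F_one)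
  \<comment> \<open>The function component of the inverse is -f composed with the inverse of
    \<open>x\<close>. The outer reduction modulo \<open>q\<close> is for the points where
    \<open>f\<close> vanishes and the difference would be \<open>q\<close>.\<close>
  define g where "g = (\<lambda>t\<in>{..<p}. (q - f (act x' t)) mod q)"
  have "f (act x' t) < q" for t using f act_less by (rule sum_zero_less)
  then have "(\<Sum>t<p. q - f (act x' t)) + (\<Sum>t<p. f (act x' t)) = (\<Sum>t<p. q)"
    unfolding sum.distrib[symmetric]
    by (simp add: less_imp_le)
  then have "q dvd (\<Sum>t<p. q - f (act x' t))"
    using sum_zero_act[OF x'(1) f] by (metis dvd_add_left_iff dvd_triv_right sum_constant)
  then have g: "g \<in> sum_zero q" unfolding g_def by (rule sum_zero_mod[OF q_pos])
  have "(\<lambda>t\<in>{..<p}. (f t + g (act x t)) mod q) = (\<lambda>t\<in>{..<p}. 0)"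
  proof (rule restrict_ext)
    fix t assume "t \<in> {..<p}"
    then have t: "t < p" by simp
    have "act x' (act x t) = t" using x' t by (simp flip: act_mult)
    then have "g (act x t) = (q - f t) mod q" by (simp add: g_def)
    then show "(f t + g (act x t)) mod q = 0"
      using sum_zero_less[OF f t] by (simp add: mod_simps)
  qed
  then have "(g, x') \<otimes>\<^bsub>G\<^esub> u = \<one>\<^bsub>G\<^esub>" using x' by (simp add: eqs del: F_mult F_one)
  then show "\<exists>v\<in>carrier G. v \<otimes>\<^bsub>G\<^esub> u = \<one>\<^bsub>G\<^esub>" using g x' by (intro bexI[of _ "(g, x')"]) auto
qed

sublocale proj: group_hom G F snd
  by unfold_locales (auto simp: hom_def simp del: F_mult F_carrier)

lemma snd_image: "snd ` carrier G = carrier F"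
  using zero_in_sum_zero by (auto simp: ext_group_def image_iff)

lemma mem_kernel_iff: "k \<in> kernel G F snd \<longleftrightarrow> (\<exists>f\<in>sum_zero q. k = (f, \<one>\<^bsub>F\<^esub>))"
  using p_pos m_pos by (cases k) (auto simp: kernel_def)

text \<open>The copy of C_p in the complement; it is the subgroup \<open>H\<close> to which the
  divisibility of degrees is applied.\<close>

definition translation_lifts :: "((nat \<Rightarrow> nat) \<times> (nat \<times> nat)) set" where
  "translation_lifts = (\<lambda>x. (\<lambda>t\<in>{..<p}. 0, x)) ` translations"

lemma subgroup_translation_lifts: "subgroup translation_lifts G"
proof -
  have "group_hom F G (\<lambda>x. (\<lambda>t\<in>{..<p}. 0, x))"
    by unfold_locales (auto simp: hom_def zero_in_sum_zero fun_eq_iff simp del: F_mult F_carrier)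
  then show ?thesis
    unfolding translation_lifts_def
    using group_hom.subgroup_img_is_subgroup translations_normal normal_imp_subgroup by blast
qed

lemma card_translation_lifts: "card translation_lifts = p"
proof -
  have "translation_lifts = (\<lambda>b. (\<lambda>t\<in>{..<p}. 0, (b, 0))) ` {..<p}"
    by (auto simp: translation_lifts_def translations_eq)
  then show ?thesis by (simp add: card_image inj_on_def)
qed

text \<open>Commuting with translation by \<open>b\<close> makes \<open>f\<close> invariant under
  the shift by \<open>b\<close>, which generates the integers modulo \<open>p\<close> when b is
  nonzero. So \<open>f\<close> is constant, its sum is p times \<open>f 0\<close>, and coprimality
  of \<open>p\<close> and \<open>q\<close> forces \<open>f 0\<close> to be divisible by
  \<open>q\<close>, hence zero.\<close>

lemma translation_lifts_fixed_point_free: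
  assumes h: "h \<in> translation_lifts" "h \<noteq> \<one>\<^bsub>G\<^esub>" and k: "k \<in> kernel G F snd"
    and comm: "k \<otimes>\<^bsub>G\<^esub> h = h \<otimes>\<^bsub>G\<^esub> k"
  shows "k = \<one>\<^bsub>G\<^esub>"
proof -
  obtain b where b: "b < p" "h = (\<lambda>t\<in>{..<p}. 0, (b, 0))"
    using h by (auto simp: translation_lifts_def translations_eq)
  obtain f where f: "f \<in> sum_zero q" "k = (f, \<one>\<^bsub>F\<^esub>)" using k mem_kernel_iff by blast
  have b0: "b \<noteq> 0" using h b by auto
  have shift: "f ((b + t) mod p) = f t" if "t < p" for t
  proof -
    have "fst (k \<otimes>\<^bsub>G\<^esub> h) t = fst (h \<otimes>\<^bsub>G\<^esub> k) t" by (simp add: comm)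
    then show ?thesis
      using that f b p_pos sum_zero_less[OF f(1), of t] sum_zero_less[OF f(1), of "(b + t) mod p"]
      by (simp add: act_def)
  qed
  have multiples: "f (b * i mod p) = f 0" for i
  proof (induction i)
    case (Suc i)
    have "f (b * Suc i mod p) = f ((b + b * i mod p) mod p)" by (simp add: mod_simps)
    also have "\<dots> = f 0" using shift[of "b * i mod p"] Suc p_pos by simp
    finally show ?case .
  qed simp
  have const: "f t = f 0" if t: "t < p" for t
  proof -
    have "coprime b p" using coprime_p[of b] b b0 by (simp add: coprime_commute)
    \<comment> \<open>With \<open>i\<close> inverse to \<open>b\<close> modulo \<open>p\<close>,
      every \<open>t\<close> is the multiple b (i t).\<close>
    then obtain i where "[b * i = 1] (mod p)" using cong_solve_coprime_nat[of b p] by auto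
    then have "[b * i * t = 1 * t] (mod p)" by (rule cong_scalar_right)
    then have "b * (i * t) mod p = t" using t by (simp add: cong_def mult.assoc)
    then show ?thesis using multiples[of "i * t"] by (simp only:)
  qed
  have "(\<Sum>t<p. f t) = (\<Sum>t<p. f 0)" by (intro sum.cong refl const) simp
  then have "(\<Sum>t<p. f t) = p * f 0" by simp
  then have "q dvd p * f 0" using f by (simp add: sum_zero_def)
  then have "q dvd f 0" using coprime_pq by (simp add: coprime_dvd_mult_right_iff coprime_commute)
  then have "f 0 = 0" using sum_zero_less[OF f(1) p_pos] by (meson dvd_imp_le leD neq0_conv)
  then have "f t = 0" if "t < p" for t using const[OF that] by (simp only:)
  then have "f = (\<lambda>t\<in>{..<p}. 0)"
    by (intro sum_zero_eqI f zero_in_sum_zero) simp_all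
  then show ?thesis using f by simp
qed

lemma card_Irr_p'_G: "card (Irr_p' p G) = m + (p - 1) div m"
proof -
  have "\<rho> k = 1\<^sub>m n"
    if "irreducible_rep G n \<rho>" "coprime n p" "k \<in> kernel G F snd" for n \<rho> k
  proof (rule ccontr)
    assume "\<rho> k \<noteq> 1\<^sub>m n"
    interpret irred_rep G n \<rho> by (rule G.irred_repI) fact
    have "p dvd n"
      using fixed_point_free_imp_card_dvd_degree[OF finite_G proj.normal_kernel subgroup_translation_lifts]
        translation_lifts_fixed_point_free \<open>\<rho> k \<noteq> 1\<^sub>m n\<close> that(3)
      by (auto simp: card_translation_lifts)
    with that(2) p_gt_1 show False by (metis coprime_absorb_right less_irrefl nat_dvd_1_iff_1)
  qed
  then have "card (Irr_p' p G) = card (Irr_p' p F)"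
    by (rule card_Irr_p'_inflate[OF G.is_group F.is_group proj.homh snd_image])
  then show ?thesis by (simp add: card_Irr_p'_F)
qed

section \<open>Solvability and order of the extension\<close>

lemma solvable_F: "solvable F"
proof (rule snd_hom.solvable_if_abelian_kernel)
  show "(\<lambda>x. int (snd x)) ` carrier F = carrier (integer_mod_group m)"
  proof (intro equalityI subsetI)
    fix j assume "j \<in> carrier (integer_mod_group m)"
    then show "j \<in> (\<lambda>x. int (snd x)) ` carrier F"
      using p_pos m_pos by (intro image_eqI[of _ _ "(0, nat j)"]) (auto simp: carrier_integer_mod_group)
  qed (use m_pos in \<open>auto simp: carrier_integer_mod_group affine_group_def\<close>)
  show "solvable (integer_mod_group m)"
    by (rule comm_group.solvable, rule group.group_comm_groupI) (simp_all add: add.commute)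
next
  fix x y
  assume "x \<in> kernel F (integer_mod_group m) (\<lambda>x. int (snd x))"
    "y \<in> kernel F (integer_mod_group m) (\<lambda>x. int (snd x))"
  then have "x \<in> translations" "y \<in> translations" by (simp_all add: translations_def)
  then show "x \<otimes>\<^bsub>F\<^esub> y = y \<otimes>\<^bsub>F\<^esub> x" by (auto simp: translations_eq add.commute)
qed

lemma solvable_G: "solvable G"
proof (rule proj.solvable_if_abelian_kernel[OF snd_image solvable_F])
  fix k l assume "k \<in> kernel G F snd" "l \<in> kernel G F snd"
  then show "k \<otimes>\<^bsub>G\<^esub> l = l \<otimes>\<^bsub>G\<^esub> k"
    by (auto simp: mem_kernel_iff add.commute fun_eq_iff)
qed

lemma order_G: "Coset.order G = card (sum_zero q) * (p * m)"
  by (simp add: Coset.order_def ext_group_def affine_group_def card_cartesian_product)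

lemma card_sum_zero_ge: "q \<le> card (sum_zero q)"
proof -
  \<comment> \<open>The function with value \<open>c\<close> at 0 and -c at 1, zero elsewhere; the
    two points exist since p > 1. These \<open>q\<close> functions already make the order
    unbounded.\<close>
  define f where "f c = (\<lambda>t\<in>{..<p}. if t = 0 then c else if t = 1 then (q - c) mod q else 0)" for c
  have "f c \<in> sum_zero q" if "c < q" for c
  proof -
    have "(\<Sum>t<p. f c t) = (\<Sum>t\<in>{0, 1}. f c t)"
      using p_gt_1 by (intro sum.mono_neutral_right) (auto simp: f_def)
    also have "\<dots> = c + (q - c) mod q" using p_gt_1 by (simp add: f_def)
    finally have "(\<Sum>t<p. f c t) mod q = 0" using that by (simp add: mod_simps)
    then show ?thesis using that q_pos by (auto simp: sum_zero_def f_def)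
  qed
  moreover have "inj_on f {..<q}"
  proof (rule inj_onI)
    fix c d assume "f c = f d"
    then have "f c 0 = f d 0" by simp
    then show "c = d" using p_pos by (simp add: f_def)
  qed
  ultimately show ?thesis
    using card_inj_on_le[of f "{..<q}" "sum_zero q"] finite_sum_zero by auto
qed

end

text \<open>The extensions consist of pairs containing functions, while the theorem speaks of groups
  on the natural numbers. An injection into \<open>nat\<close> transports the structure; it is a
  surjective homomorphism with trivial kernel, so the inflation argument also preserves the
  character count.\<close>

lemma (in group) ex_nat_copy:
  assumes fin: "finite (carrier G)"
  shows "\<exists>H :: nat monoid. group H \<and> finite (carrier H) \<and> Coset.order H = Coset.order G \<and>
    (solvable G \<longrightarrow> solvable H) \<and> (\<forall>p. card (Irr_p' p H) = card (Irr_p' p G))"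
proof -
  have G: "group G" by (rule is_group)
  obtain f :: "'a \<Rightarrow> nat" where f: "inj_on f (carrier G)"
    using finite_imp_inj_to_nat_seg[OF fin] by blast
  define H where "H = image_group f G"
  have iso: "f \<in> iso G H" unfolding H_def by (rule inj_imp_image_group_iso[OF f])
  have H: "group H" unfolding H_def by (rule inj_imp_image_group_is_group[OF f])
  have im: "f ` carrier G = carrier H" by (simp add: H_def image_group_carrier)
  have hom: "f \<in> hom G H" using iso by (simp add: iso_def)
  interpret group_hom G H f using H hom by (simp add: group_hom_def group_hom_axioms_def)
  have ker: "kernel G H f = {\<one>}" using f inj_iff_trivial_ker by blast
  have "card (Irr_p' p G) = card (Irr_p' p H)" for p
  proof (rule card_Irr_p'_inflate[OF G H hom im])
    fix n \<rho> k assume irr: "irreducible_rep G n \<rho>" and "k \<in> kernel G H f"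
    interpret irred_rep G n \<rho> using G irr by (rule group.irred_repI)
    show "\<rho> k = 1\<^sub>m n" using \<open>k \<in> kernel G H f\<close> ker by simp
  qed
  moreover have "Coset.order H = Coset.order G"
    unfolding Coset.order_def im[symmetric] by (rule card_image[OF f])
  moreover have "finite (carrier H)" using fin im by (metis finite_imageI)
  ultimately show ?thesis
    using H surj_hom_imp_solvable[OF im] by (intro exI[of _ H]) simp
qed

text \<open>Choosing one group for each order that occurs gives a family in which different members
  have different orders and so cannot be isomorphic; unbounded orders make it infinite.\<close>

lemma infinite_pairwise_non_iso:
  fixes P :: "('a, 'b) monoid_scheme \<Rightarrow> bool"
  assumes "\<And>N. \<exists>G. P G \<and> N \<le> Coset.order G"
  shows "\<exists>S. infinite S \<and> pairwise (\<lambda>G H. \<not> G \<cong> H) S \<and> (\<forall>G\<in>S. P G)"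
proof -
  define A where "A = {Coset.order G | G. P G}"
  define rep where "rep n = (SOME G. P G \<and> Coset.order G = n)" for n
  have rep: "P (rep n)" "Coset.order (rep n) = n" if "n \<in> A" for n
    using that someI_ex[of "\<lambda>G. P G \<and> Coset.order G = n"] unfolding A_def rep_def by auto
  have "infinite A"
    unfolding infinite_nat_iff_unbounded_le A_def using assms by blast
  moreover have "inj_on rep A" by (rule inj_onI) (metis rep(2))
  ultimately have "infinite (rep ` A)" by (simp add: finite_image_iff)
  moreover have "pairwise (\<lambda>G H. \<not> G \<cong> H) (rep ` A)"
  proof (rule pairwiseI)
    fix G H assume "G \<in> rep ` A" "H \<in> rep ` A" "G \<noteq> H"
    then have "Coset.order G \<noteq> Coset.order H" using rep(2) by auto
    then show "\<not> G \<cong> H" using iso_same_card unfolding Coset.order_def by blast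
  qed
  ultimately show ?thesis using rep(1) by blast
qed

theorem proposition6p3:
  fixes p :: nat
  assumes "prime p" and "sqrt (real p - 1) \<in> \<int>"
  shows "\<exists>S :: nat monoid set. infinite S \<and>
           pairwise (\<lambda>G H. \<not> G \<cong> H) S \<and>
           (\<forall>G\<in>S. group G \<and> finite (carrier G) \<and> solvable G \<and> p dvd Coset.order G \<and>
                   real (card (Irr_p' p G)) = 2 * sqrt (real p - 1))"
proof (rule infinite_pairwise_non_iso)
  fix N :: nat
  have p_gt: "p > 1" using assms(1) prime_gt_1_nat by blast
  obtain z where z: "sqrt (real p - 1) = of_int z" using assms(2) by (rule Ints_cases)
  define m where "m = nat z"
  have "0 < sqrt (real p - 1)" using p_gt by simp
  then have m: "sqrt (real p - 1) = real m" "m > 0" unfolding m_def z by simp_all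
  have "real m * real m = real p - 1" using p_gt by (simp flip: m(1))
  then have "real (m * m) = real (p - 1)" using p_gt by (simp add: of_nat_diff)
  then have mm: "p - 1 = m * m" by (simp only: of_nat_eq_iff)
  \<comment> \<open>For a primitive root \<open>g\<close>, the power g^m has order (p - 1) / gcd(m,
    p - 1) = m^2 / m = m, so it can serve as the multiplier.\<close>
  obtain g where g: "ord p g = p - 1" using residue_prime_has_primroot[OF assms(1)] by blast
  have "ord p (g ^ m) * gcd m (m * m) = m * m" using ord_power_aux[of p g m] unfolding g mm .
  then have ord: "ord p (g ^ m) = m" using m by simp
  \<comment> \<open>This \<open>q\<close> is 1 modulo \<open>p\<close>, hence coprime to it, and at
    least \<open>N\<close>.\<close>
  define q where "q = p * N + 1"
  have "coprime p q"
    unfolding q_def by (rule coprimeI) (metis dvd_add_right_iff dvd_mult2)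
  then interpret affine_ext p m "g ^ m" q
    using assms(1) m ord by unfold_locales (auto simp: q_def)
  obtain H :: "nat monoid" where H: "group H" "finite (carrier H)" "Coset.order H = Coset.order G"
    "solvable H" "\<And>p. card (Irr_p' p H) = card (Irr_p' p G)"
    using G.ex_nat_copy[OF finite_G] solvable_G by blast
  have "(p - 1) div m = m" unfolding mm using m by simp
  then have "real (card (Irr_p' p H)) = 2 * sqrt (real p - 1)"
    unfolding H(5) card_Irr_p'_G m(1) by simp
  moreover have "p dvd Coset.order H" by (simp add: H(3) order_G)
  moreover have "N \<le> Coset.order H"
  proof -
    have "N \<le> q" using p_gt by (cases p) (auto simp: q_def)
    also have "\<dots> \<le> card (sum_zero q)" by (rule card_sum_zero_ge)
    also have "\<dots> \<le> card (sum_zero q) * (p * m)" using p_pos m_pos by simp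
    finally show ?thesis by (simp add: H(3) order_G)
  qed
  ultimately show "\<exists>G :: nat monoid. (group G \<and> finite (carrier G) \<and> solvable G \<and> p dvd Coset.order G \<and>
      real (card (Irr_p' p G)) = 2 * sqrt (real p - 1)) \<and> N \<le> Coset.order G"
    using H by blast
qed

end
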